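(* The logic $\mathsf{GS4}$ is decidable: there is an algorithm which, given a formula $\varphi$ of $\mathcal L$, decides whether $\varphi\in\mathsf{GS4}$.
   Context: Fix a countably infinite set $\mathbb P$ of propositional variables. The language $\mathcal L$: $\varphi ::= p \mid \bot \mid (\varphi\wedge\varphi)\mid(\varphi\vee\varphi)\mid(\varphi\to\varphi)\mid\Diamond\varphi\mid\Box\varphi$, $p\in\mathbb P$; $\neg\varphi:=\varphi\to\bot$. A logic is a set of formulas closed under substitution. $\mathsf{CS4}$ is the smallest logic containing all intuitionistic propositional tautologies (in $\mathcal L$) and the axioms $\Box(p\to q)\to(\Box p\to\Box q)$, $\Box(p\to q)\to(\Diamond p\to\Diamond q)$, $\Box p\to p$, $p\to\Diamond p$, $\Diamond\Diamond p\to\Diamond p$, $\Box p\to\Box\Box p$, and closed under modus ponens and necessitation (from $\varphi$ infer $\Box\varphi$). $\mathsf{GS4}$ is the smallest such logic extending $\mathsf{CS4}$ that also contains $\Diamond(p\vee q)\to\Diamond p\vee\Diamond q$, $\neg\Diamond\bot$, $(\Diamond p\to\Box q)\to\Box(p\to q)$ and $(p\to q)\vee(q\to p)$. *)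

theory Defs
  imports Main "HOL-Library.Nat_Bijection"
begin

datatype fm =
    Var nat
  | Bot  (\<open>\<^bold>\<bottom>\<close>)
  | Conj fm fm  (infixr \<open>\<^bold>\<and>\<close> 60)
  | Disj fm fm  (infixr \<open>\<^bold>\<or>\<close> 55)
  | Impl fm fm  (infixr \<open>\<^bold>\<longrightarrow>\<close> 50)
  | Dia fm  (\<open>\<^bold>\<diamond> _\<close> [70] 70)
  | Box fm  (\<open>\<^bold>\<box> _\<close> [70] 70)

abbreviation Neg :: "fm \<Rightarrow> fm"  (\<open>\<^bold>\<not> _\<close> [70] 70)
  where "\<^bold>\<not> \<phi> \<equiv> \<phi> \<^bold>\<longrightarrow> \<^bold>\<bottom>"

primrec subst :: "(nat \<Rightarrow> fm) \<Rightarrow> fm \<Rightarrow> fm" where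
  "subst \<sigma> (Var n) = \<sigma> n"
| "subst \<sigma> \<^bold>\<bottom> = \<^bold>\<bottom>"
| "subst \<sigma> (\<phi> \<^bold>\<and> \<psi>) = (subst \<sigma> \<phi> \<^bold>\<and> subst \<sigma> \<psi>)"
| "subst \<sigma> (\<phi> \<^bold>\<or> \<psi>) = (subst \<sigma> \<phi> \<^bold>\<or> subst \<sigma> \<psi>)"
| "subst \<sigma> (\<phi> \<^bold>\<longrightarrow> \<psi>) = (subst \<sigma> \<phi> \<^bold>\<longrightarrow> subst \<sigma> \<psi>)"
| "subst \<sigma> (\<^bold>\<diamond> \<phi>) = \<^bold>\<diamond> (subst \<sigma> \<phi>)"
| "subst \<sigma> (\<^bold>\<box> \<phi>) = \<^bold>\<box> (subst \<sigma> \<phi>)"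

definition is_logic :: "fm set \<Rightarrow> bool" where
  "is_logic L \<longleftrightarrow> (\<forall>\<sigma>. \<forall>\<phi>\<in>L. subst \<sigma> \<phi> \<in> L)"

definition closed_mp :: "fm set \<Rightarrow> bool" where
  "closed_mp L \<longleftrightarrow> (\<forall>\<phi> \<psi>. \<phi> \<in> L \<and> (\<phi> \<^bold>\<longrightarrow> \<psi>) \<in> L \<longrightarrow> \<psi> \<in> L)"

definition closed_nec :: "fm set \<Rightarrow> bool" where
  "closed_nec L \<longleftrightarrow> (\<forall>\<phi>\<in>L. \<^bold>\<box> \<phi> \<in> L)"

text \<open>The intuitionistic propositional tautologies in the full language: the theorems of a
  Hilbert calculus whose axiom schemes range over all modal formulas. These are exactly the
  substitution instances of the theorems of intuitionistic propositional logic.\<close>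

inductive_set IPC :: "fm set" where
  K: "(\<phi> \<^bold>\<longrightarrow> \<psi> \<^bold>\<longrightarrow> \<phi>) \<in> IPC"
| S: "((\<phi> \<^bold>\<longrightarrow> \<psi> \<^bold>\<longrightarrow> \<chi>) \<^bold>\<longrightarrow> (\<phi> \<^bold>\<longrightarrow> \<psi>) \<^bold>\<longrightarrow> \<phi> \<^bold>\<longrightarrow> \<chi>) \<in> IPC"
| conjE1: "(\<phi> \<^bold>\<and> \<psi> \<^bold>\<longrightarrow> \<phi>) \<in> IPC"
| conjE2: "(\<phi> \<^bold>\<and> \<psi> \<^bold>\<longrightarrow> \<psi>) \<in> IPC"
| conjI: "(\<phi> \<^bold>\<longrightarrow> \<psi> \<^bold>\<longrightarrow> \<phi> \<^bold>\<and> \<psi>) \<in> IPC"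
| disjI1: "(\<phi> \<^bold>\<longrightarrow> \<phi> \<^bold>\<or> \<psi>) \<in> IPC"
| disjI2: "(\<psi> \<^bold>\<longrightarrow> \<phi> \<^bold>\<or> \<psi>) \<in> IPC"
| disjE: "((\<phi> \<^bold>\<longrightarrow> \<chi>) \<^bold>\<longrightarrow> (\<psi> \<^bold>\<longrightarrow> \<chi>) \<^bold>\<longrightarrow> \<phi> \<^bold>\<or> \<psi> \<^bold>\<longrightarrow> \<chi>) \<in> IPC"
| botE: "(\<^bold>\<bottom> \<^bold>\<longrightarrow> \<phi>) \<in> IPC"
| mp: "\<lbrakk>\<phi> \<in> IPC; (\<phi> \<^bold>\<longrightarrow> \<psi>) \<in> IPC\<rbrakk> \<Longrightarrow> \<psi> \<in> IPC"

definition CS4_axioms :: "fm set" where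
  "CS4_axioms = (let p = Var 0; q = Var 1 in
    { \<^bold>\<box> (p \<^bold>\<longrightarrow> q) \<^bold>\<longrightarrow> (\<^bold>\<box> p \<^bold>\<longrightarrow> \<^bold>\<box> q),
      \<^bold>\<box> (p \<^bold>\<longrightarrow> q) \<^bold>\<longrightarrow> (\<^bold>\<diamond> p \<^bold>\<longrightarrow> \<^bold>\<diamond> q),
      \<^bold>\<box> p \<^bold>\<longrightarrow> p,
      p \<^bold>\<longrightarrow> \<^bold>\<diamond> p,
      \<^bold>\<diamond> \<^bold>\<diamond> p \<^bold>\<longrightarrow> \<^bold>\<diamond> p,
      \<^bold>\<box> p \<^bold>\<longrightarrow> \<^bold>\<box> \<^bold>\<box> p })"

definition GS4_axioms :: "fm set" where
  "GS4_axioms = (let p = Var 0; q = Var 1 in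
    { \<^bold>\<diamond> (p \<^bold>\<or> q) \<^bold>\<longrightarrow> \<^bold>\<diamond> p \<^bold>\<or> \<^bold>\<diamond> q,
      \<^bold>\<not> \<^bold>\<diamond> \<^bold>\<bottom>,
      (\<^bold>\<diamond> p \<^bold>\<longrightarrow> \<^bold>\<box> q) \<^bold>\<longrightarrow> \<^bold>\<box> (p \<^bold>\<longrightarrow> q),
      (p \<^bold>\<longrightarrow> q) \<^bold>\<or> (q \<^bold>\<longrightarrow> p) })"

definition CS4 :: "fm set" where
  "CS4 = \<Inter> {L. is_logic L \<and> closed_mp L \<and> closed_nec L \<and> IPC \<subseteq> L \<and> CS4_axioms \<subseteq> L}"

definition GS4 :: "fm set" where
  "GS4 = \<Inter> {L. is_logic L \<and> closed_mp L \<and> closed_nec L \<and> CS4 \<subseteq> L \<and> GS4_axioms \<subseteq> L}"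

text \<open>Algorithms are terms for Kleene's partial recursive functions. The relation
  \<open>evals f xs y\<close> says that \<open>f\<close> halts on the arguments \<open>xs\<close> with output \<open>y\<close>. A term that is
  applied to a list of unsuitable length need not halt.\<close>

datatype recf =
    Zero
  | Succ
  | Proj nat
  | Comp recf "recf list"
  | Prim recf recf
  | Mu recf

inductive evals :: "recf \<Rightarrow> nat list \<Rightarrow> nat \<Rightarrow> bool" where
  zero: "evals Zero xs 0"
| succ: "evals Succ [x] (Suc x)"
| proj: "i < length xs \<Longrightarrow> evals (Proj i) xs (xs ! i)"
| comp: "\<lbrakk>list_all2 (\<lambda>g y. evals g xs y) gs ys; evals f ys z\<rbrakk> \<Longrightarrow> evals (Comp f gs) xs z"
| prim_0: "evals f xs y \<Longrightarrow> evals (Prim f g) (0 # xs) y"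
| prim_Suc: "\<lbrakk>evals (Prim f g) (n # xs) y; evals g (n # y # xs) z\<rbrakk>
    \<Longrightarrow> evals (Prim f g) (Suc n # xs) z"
| mu: "\<lbrakk>evals f (n # xs) 0; \<forall>i<n. \<exists>y>0. evals f (i # xs) y\<rbrakk> \<Longrightarrow> evals (Mu f) xs n"

inductive_cases evals_elims:
  "evals Zero xs y"
  "evals Succ xs y"
  "evals (Proj i) xs y"
  "evals (Comp f gs) xs y"
  "evals (Prim f g) (0 # xs) y"
  "evals (Prim f g) (Suc n # xs) y"
  "evals (Mu f) xs y"

lemma evals_deterministic: "evals f xs y \<Longrightarrow> evals f xs z \<Longrightarrow> y = z"
proof (induction arbitrary: z rule: evals.induct)
  case (zero xs)
  then show ?case by (rule evals_elims(1)) simp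
next
  case (succ x)
  then show ?case by (rule evals_elims(2)) simp
next
  case (proj i xs)
  from proj(2) show ?case by (rule evals_elims(3)) simp
next
  case (comp xs gs ys f w)
  from comp.prems obtain ys' where ys': "list_all2 (\<lambda>g y. evals g xs y) gs ys'" "evals f ys' z"
    by (rule evals_elims(4))
  have "length ys = length ys'"
    using list_all2_lengthD[OF comp.IH(1)] list_all2_lengthD[OF ys'(1)] by simp
  moreover have "ys ! i = ys' ! i" if "i < length ys" for i
  proof -
    have i: "i < length gs" using that list_all2_lengthD[OF comp.IH(1)] by simp
    have "\<forall>z. evals (gs ! i) xs z \<longrightarrow> ys ! i = z"
      using list_all2_nthD[OF comp.IH(1) i] by blast
    with list_all2_nthD[OF ys'(1) i] show ?thesis by blast
  qed
  ultimately have "ys = ys'" by (rule nth_equalityI)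
  with comp.IH(2) ys'(2) show ?case by simp
next
  case (prim_0 f xs y g)
  from prim_0.prems show ?case
    by (rule evals_elims(5)) (rule prim_0.IH)
next
  case (prim_Suc f g n xs y w)
  from prim_Suc.prems show ?case
    by (rule evals_elims(6)) (use prim_Suc.IH in blast)
next
  case (mu f n xs)
  have z: "evals f (z # xs) 0" "\<forall>i<z. \<exists>y>0. evals f (i # xs) y"
    using mu.prems by (blast elim: evals_elims(7))+
  have "\<not> z < n"
  proof
    assume "z < n"
    then obtain y where "y > 0" "\<forall>w. evals f (z # xs) w \<longrightarrow> y = w" using mu.IH(2) by blast
    with z(1) show False by blast
  qed
  moreover have "\<not> n < z"
  proof
    assume "n < z"
    then obtain y where "y > 0" "evals f (n # xs) y" using z(2) by blast
    with mu.IH(1) show False by blast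
  qed
  ultimately show ?case by simp
qed

primrec code :: "fm \<Rightarrow> nat" where
  "code (Var n) = prod_encode (0, n)"
| "code \<^bold>\<bottom> = prod_encode (1, 0)"
| "code (\<phi> \<^bold>\<and> \<psi>) = prod_encode (2, prod_encode (code \<phi>, code \<psi>))"
| "code (\<phi> \<^bold>\<or> \<psi>) = prod_encode (3, prod_encode (code \<phi>, code \<psi>))"
| "code (\<phi> \<^bold>\<longrightarrow> \<psi>) = prod_encode (4, prod_encode (code \<phi>, code \<psi>))"
| "code (\<^bold>\<diamond> \<phi>) = prod_encode (5, code \<phi>)"
| "code (\<^bold>\<box> \<phi>) = prod_encode (6, code \<phi>)"

lemma code_inject: "code \<phi> = code \<psi> \<longleftrightarrow> \<phi> = \<psi>"
proof (induction \<phi> arbitrary: \<psi>)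
  case (Var n) show ?case by (cases \<psi>) auto
next
  case Bot show ?case by (cases \<psi>) auto
next
  case (Conj \<phi>1 \<phi>2) then show ?case by (cases \<psi>) auto
next
  case (Disj \<phi>1 \<phi>2) then show ?case by (cases \<psi>) auto
next
  case (Impl \<phi>1 \<phi>2) then show ?case by (cases \<psi>) auto
next
  case (Dia \<phi>) then show ?case by (cases \<psi>) auto
next
  case (Box \<phi>) then show ?case by (cases \<psi>) auto
qed

text \<open>A set of formulas is decidable if a single algorithm, run on the code of any formula,
  halts with output 1 if the formula is in the set and with output 0 otherwise.\<close>

definition decidable :: "fm set \<Rightarrow> bool" where
  "decidable A \<longleftrightarrow> (\<exists>f. \<forall>\<phi>. evals f [code \<phi>] (if \<phi> \<in> A then 1 else 0))"

end

(* GS4 is sound for birelational frames: a preorder in which the points above any given point are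
   pairwise comparable, and a reflexive transitive accessibility relation with forward and backward
   confluence. The prime theories form a canonical model. For a bound c, let the type of a prime
   theory Gamma be the set of the traces, on the formulas with code at most c, of all prime theories
   extending Gamma. By the Goedel-Dummett axiom the prime theories extending Gamma form a chain, so
   that types form a bisimulation quotient of the inclusion order; there are at most 2^2^(c+1)
   of them. Confluence survives this quotient and also the transitive closure of the induced
   accessibility relation; boxed formulas are preserved along it and diamond formulas against it,
   so the types are a finite countermodel for every non-theorem of code c. The existence of a
   countermodel of bounded size is an arithmetical statement with bounded quantifiers only, hence
   recursive. *)
theory Submission
  imports Defs
begin

section \<open>Recursive functions and decidable predicates\<close>

text \<open>Identifying prime theories by their traces alone is too coarse: theories with the same
  trace can have different extensions, and then order steps between classes need not compose or
  lift. Recording the traces of everything above makes an order step liftable to every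
  representative of its source. Accessibility has no such lifting, so its image may lose
  transitivity. Closing it transitively is harmless, because confluence squares can be pasted along
  a path and because Box and Dia formulas, unlike arbitrary ones, travel along whole paths by the
  transitivity axioms. Of the axioms beyond CS4, distribution of Dia over disjunction and the
  refutation of Dia Bot make the formulas whose Dia fails a nonempty directed set, which yields
  prime successors; (Dia p -> Box q) -> Box (p -> q) yields backward confluence. Since the size of a
  countermodel is bounded in advance, the search for one decides by itself, and derivations are
  never coded.\<close>

text \<open>Arguments are given by an environment of which only the first \<open>n\<close> values may be used. A bound
  variable is prepended to the environment, so the bodies of recursions and bounded quantifiers
  arise by shifting indices.\<close>

definition computable :: "nat \<Rightarrow> ((nat \<Rightarrow> nat) \<Rightarrow> nat) \<Rightarrow> bool" where
  "computable n f \<longleftrightarrow> (\<exists>r. \<forall>e. evals r (map e [0..<n]) (f e))"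

definition decides :: "nat \<Rightarrow> ((nat \<Rightarrow> nat) \<Rightarrow> bool) \<Rightarrow> bool" where
  "decides n P \<longleftrightarrow> computable n (\<lambda>e. of_bool (P e))"

lemma computable_var: "i < n \<Longrightarrow> computable n (\<lambda>e. e i)"
  unfolding computable_def
proof (intro exI allI)
  fix e :: "nat \<Rightarrow> nat"
  assume "i < n"
  then show "evals (Proj i) (map e [0..<n]) (e i)"
    using evals.proj[of i "map e [0..<n]"] by simp
qed

lemma computable_0: "computable n (\<lambda>e. 0)"
  unfolding computable_def by (intro exI allI) (rule evals.zero)

lemma computable_Suc:
  assumes "computable n f" shows "computable n (\<lambda>e. Suc (f e))"
proof -
  obtain r where r: "\<And>e. evals r (map e [0..<n]) (f e)"
    using assms unfolding computable_def by blast
  have "evals (Comp Succ [r]) (map e [0..<n]) (Suc (f e))" for e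
    by (rule evals.comp[of _ _ "[f e]"]) (auto intro: r evals.succ)
  then show ?thesis unfolding computable_def by blast
qed

text \<open>\<open>prim_Suc\<close> passes the counter and the previous value in front of the
  parameters, hence the positions 0 and 1 and the shift by two. In the conclusion \<open>G\<close>
  is applied to bound variables only, so unification can find it.\<close>

lemma computable_rec_nat:
  assumes "computable n m" "computable n b"
    and "computable (Suc (Suc n)) (\<lambda>e. G (e 0) (e (Suc 0)) (\<lambda>i. e (Suc (Suc i))))"
  shows "computable n (\<lambda>e. rec_nat (b e) (\<lambda>k y. G k y e) (m e))"
proof -
  obtain rm rb rG where rm: "\<And>e. evals rm (map e [0..<n]) (m e)"
    and rb: "\<And>e. evals rb (map e [0..<n]) (b e)"
    and rG: "\<And>e. evals rG (map e [0..<Suc (Suc n)]) (G (e 0) (e (Suc 0)) (\<lambda>i. e (Suc (Suc i))))"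
    using assms unfolding computable_def by blast
  have step: "evals rG (k # y # map e [0..<n]) (G k y e)" for k y e
  proof -
    have "map (case_nat k (case_nat y e)) [0..<Suc (Suc n)] = k # y # map e [0..<n]"
      by (simp add: upt_conv_Cons map_Suc_upt[symmetric] del: upt_Suc)
    then show ?thesis using rG[of "case_nat k (case_nat y e)"] by simp
  qed
  have prim: "evals (Prim rb rG) (k # map e [0..<n]) (rec_nat (b e) (\<lambda>k y. G k y e) k)" for k e
    by (induction k) (auto intro: evals.prim_0 evals.prim_Suc rb step)
  have "evals (Comp (Prim rb rG) (rm # map Proj [0..<n])) (map e [0..<n])
      (rec_nat (b e) (\<lambda>k y. G k y e) (m e))" for e
  proof (rule evals.comp[of _ _ "m e # map e [0..<n]"])
    show "list_all2 (\<lambda>g. evals g (map e [0..<n])) (rm # map Proj [0..<n]) (m e # map e [0..<n])"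
      using evals.proj[of _ "map e [0..<n]"]
      by (simp add: rm list_all2_map1 list_all2_map2 list_all2_same)
  qed (rule prim)
  then show ?thesis unfolding computable_def by blast
qed


lemma computable_shift:
  assumes "computable n f" shows "computable (k + n) (\<lambda>e. f (\<lambda>i. e (k + i)))"
proof -
  obtain r where r: "\<And>e. evals r (map e [0..<n]) (f e)"
    using assms unfolding computable_def by blast
  have "evals (Comp r (map Proj [k..<k + n])) (map e [0..<k + n]) (f (\<lambda>i. e (k + i)))" for e
  proof (rule evals.comp)
    show "list_all2 (\<lambda>g. evals g (map e [0..<k + n])) (map Proj [k..<k + n])
        (map (\<lambda>i. e (k + i)) [0..<n])"
      using evals.proj[of _ "map e [0..<k + n]"] by (auto simp: list_all2_conv_all_nth)
  qed (rule r)
  then show ?thesis unfolding computable_def by blast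
qed

lemma computable_shift1:
  "computable n f \<Longrightarrow> computable (Suc n) (\<lambda>e. f (\<lambda>i. e (Suc i)))"
  using computable_shift[of n f 1] by simp

lemma computable_shift2:
  "computable n f \<Longrightarrow> computable (Suc (Suc n)) (\<lambda>e. f (\<lambda>i. e (Suc (Suc i))))"
  using computable_shift[of n f 2] by simp

section \<open>Arithmetical functions\<close>

lemma computable_add:
  assumes "computable n f" "computable n g" shows "computable n (\<lambda>e. f e + g e)"
proof -
  have "x + y = rec_nat y (\<lambda>_. Suc) x" for x y :: nat by (induction x) auto
  then show ?thesis
    by (simp only:) (intro computable_rec_nat computable_Suc computable_var assms; simp)
qed

lemma computable_mult:
  assumes "computable n f" "computable n g" shows "computable n (\<lambda>e. f e * g e)"
proof -
  have "x * y = rec_nat 0 (\<lambda>_ z. z + y) x" for x y :: nat by (induction x) auto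
  then show ?thesis
    by (simp only:) (intro computable_rec_nat computable_0 computable_add computable_var assms(1)
        computable_shift2[OF assms(2)]; simp)
qed

lemma computable_power2:
  assumes "computable n f" shows "computable n (\<lambda>e. 2 ^ f e)"
proof -
  have "2 ^ x = rec_nat (Suc 0) (\<lambda>_ z. z + z) x" for x :: nat by (induction x) auto
  then show ?thesis
    by (simp only:) (intro computable_rec_nat computable_0 computable_Suc computable_add
        computable_var assms; simp)
qed

lemma computable_pred:
  assumes "computable n f" shows "computable n (\<lambda>e. f e - 1)"
proof -
  have "x - 1 = rec_nat 0 (\<lambda>k _. k) x" for x :: nat by (cases x) auto
  then show ?thesis
    by (simp only:) (intro computable_rec_nat computable_0 computable_var assms; simp)
qed

lemma computable_diff:
  assumes "computable n f" "computable n g" shows "computable n (\<lambda>e. f e - g e)"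
proof -
  have "x - y = rec_nat x (\<lambda>_ z. z - 1) y" for x y :: nat by (induction y) auto
  \<comment> \<open>The recursion contains the subtraction \<open>z - 1\<close>, so this equation
    would loop as a rewrite rule; it is applied once, to the whole function.\<close>
  then have eq: "(\<lambda>e. f e - g e) = (\<lambda>e. rec_nat (f e) (\<lambda>_ z. z - 1) (g e))" by blast
  show ?thesis
    by (subst eq) (intro computable_rec_nat computable_pred computable_var assms; simp)
qed

lemma computable_prod_encode:
  assumes "computable n f" "computable n g" shows "computable n (\<lambda>e. prod_encode (f e, g e))"
proof -
  have "triangle x = rec_nat 0 (\<lambda>k z. z + Suc k) x" for x by (induction x) auto
  then show ?thesis
    unfolding prod_encode_def prod.case
    by (simp only:) (intro computable_rec_nat computable_0 computable_Suc computable_add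
        computable_var assms; simp)
qed

section \<open>Connectives and bounded quantifiers\<close>

lemma decides_le:
  assumes "computable n f" "computable n g" shows "decides n (\<lambda>e. f e \<le> g e)"
proof -
  have "of_bool (x \<le> y) = 1 - (x - y)" for x y :: nat by simp
  then show ?thesis
    unfolding decides_def One_nat_def
    by (simp only:) (intro computable_diff computable_Suc computable_0 assms)
qed

lemma decides_not:
  assumes "decides n P" shows "decides n (\<lambda>e. \<not> P e)"
proof -
  have "of_bool (\<not> P) = 1 - (of_bool P :: nat)" for P by simp
  then show ?thesis
    using assms unfolding decides_def One_nat_def
    by (simp only:) (intro computable_diff computable_Suc computable_0)
qed

lemma decides_conj:
  assumes "decides n P" "decides n Q" shows "decides n (\<lambda>e. P e \<and> Q e)"
  using assms unfolding decides_def of_bool_conj by (rule computable_mult)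

lemma decides_disj:
  assumes "decides n P" "decides n Q" shows "decides n (\<lambda>e. P e \<or> Q e)"
  using decides_not[OF decides_conj[OF assms[THEN decides_not]]] by (simp only: de_Morgan_conj not_not)

lemma decides_imp:
  assumes "decides n P" "decides n Q" shows "decides n (\<lambda>e. P e \<longrightarrow> Q e)"
  using decides_disj[OF decides_not[OF assms(1)] assms(2)] by (simp only: imp_conv_disj)

lemma decides_iff:
  assumes "decides n P" "decides n Q" shows "decides n (\<lambda>e. P e \<longleftrightarrow> Q e)"
  using decides_conj[OF decides_imp[OF assms] decides_imp[OF assms(2,1)]]
  by (simp only: iff_conv_conj_imp[symmetric])

lemma decides_eq:
  assumes "computable n f" "computable n g" shows "decides n (\<lambda>e. f e = g e)"
  using decides_conj[OF decides_le[OF assms] decides_le[OF assms(2,1)]]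
  by (simp only: eq_iff[symmetric])

lemma decides_all:
  assumes "computable n b" "decides (Suc n) (\<lambda>e. P (e 0) (\<lambda>i. e (Suc i)))"
  shows "decides n (\<lambda>e. \<forall>i < b e. P i e)"
proof -
  have "of_bool (\<forall>i < m. P i e) = rec_nat (Suc 0) (\<lambda>k z. z * of_bool (P k e)) m" for m e
    by (induction m) (simp_all add: All_less_Suc of_bool_conj mult.commute)
  moreover have C: "computable (Suc (Suc n)) (\<lambda>e. of_bool (P (e 0) (\<lambda>i. e (Suc (Suc i)))))"
  proof -
    obtain r where r: "\<And>e. evals r (map e [0..<Suc n]) (of_bool (P (e 0) (\<lambda>i. e (Suc i))))"
      using assms(2) unfolding decides_def computable_def by blast
    \<comment> \<open>Inside the recursion position 1 holds the accumulated truth value, which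
      \<open>P\<close> does not see: its decider gets the counter and then the parameters from
      position 2 on.\<close>
    define js where "js = 0 # map (\<lambda>i. Suc (Suc i)) [0..<n]"
    have "evals (Comp r (map Proj js)) (map e [0..<Suc (Suc n)])
        (of_bool (P (e 0) (\<lambda>i. e (Suc (Suc i)))))" for e
    proof (rule evals.comp)
      let ?e = "case_nat (e 0) (\<lambda>i. e (Suc (Suc i)))"
      have "evals (Proj j) (map e [0..<Suc (Suc n)]) (e j)" if "j \<in> set js" for j
        using evals.proj[of j "map e [0..<Suc (Suc n)]"] that by (auto simp: js_def nth_append simp del: upt_Suc)
      moreover have "map ?e [0..<Suc n] = map e js"
        by (simp add: js_def upt_conv_Cons map_Suc_upt[symmetric] del: upt_Suc)
      ultimately show "list_all2 (\<lambda>g. evals g (map e [0..<Suc (Suc n)]))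
          (map Proj js) (map ?e [0..<Suc n])"
        by (simp add: list_all2_map1 list_all2_map2 list_all2_same del: upt_Suc)
      show "evals r (map ?e [0..<Suc n]) (of_bool (P (e 0) (\<lambda>i. e (Suc (Suc i)))))"
        using r[of ?e] by simp
    qed
    then show ?thesis unfolding computable_def by blast
  qed
  ultimately show ?thesis
    unfolding decides_def
    by (simp only:) (intro computable_rec_nat computable_mult computable_Suc computable_0
        computable_var C assms(1); simp)
qed

lemma decides_ex:
  assumes "computable n b" "decides (Suc n) (\<lambda>e. P (e 0) (\<lambda>i. e (Suc i)))"
  shows "decides n (\<lambda>e. \<exists>i < b e. P i e)"
  using decides_not[OF decides_all[OF assms(1) decides_not[OF assms(2)]]]
  by (simp only: not_all not_imp not_not)

text \<open>Expresses the bit of weight \<open>2 ^ k\<close> by bounded quantifiers over sums,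
  products and powers of two, so that \<open>set_decode\<close> needs no computable
  division.\<close>

lemma odd_div_iff: "odd (x div 2 ^ k) \<longleftrightarrow> (\<exists>q < Suc x. \<exists>r < 2 ^ k. x = Suc (q + q) * 2 ^ k + r)"
    (is "?l \<longleftrightarrow> ?r")
  for x k :: nat
proof
  assume ?l
  then obtain q where "x div 2 ^ k = 2 * q + 1" by (rule oddE)
  then have q: "x div 2 ^ k = Suc (q + q)" by simp
  have "x = (x div 2 ^ k) * 2 ^ k + x mod 2 ^ k" by (rule div_mult_mod_eq[symmetric])
  then have "x = Suc (q + q) * 2 ^ k + x mod 2 ^ k" unfolding q .
  moreover have "q < Suc x" using q div_le_dividend[of x "2 ^ k"] by linarith
  moreover have "x mod 2 ^ k < 2 ^ k" by simp
  ultimately show ?r by blast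
next
  assume ?r
  then obtain q r where r: "r < 2 ^ k" and x: "x = Suc (q + q) * 2 ^ k + r" by blast
  have "x div 2 ^ k = Suc (q + q)"
    using r unfolding x by (subst div_mult_self3) auto
  then show ?l by simp
qed

lemma decides_mem_set_decode:
  assumes "computable n f" "computable n g"
  shows "decides n (\<lambda>e. g e \<in> set_decode (f e))"
  unfolding set_decode_def mem_Collect_eq odd_div_iff
  by (intro decides_ex decides_eq computable_add computable_mult computable_power2
      computable_Suc computable_var assms assms(2)[THEN computable_shift1]
      assms[THEN computable_shift2]; simp)

lemmas computable_intros =
  computable_var computable_0 computable_Suc computable_add computable_mult computable_power2
  computable_prod_encode decides_le decides_not decides_conj decides_disj decides_imp decides_iff
  decides_eq decides_all decides_ex decides_mem_set_decode

lemma computable_const: "computable n (\<lambda>e. k)"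
  by (induction k) (auto intro: computable_intros)

section \<open>Birelational semantics\<close>

locale gs4_frame =
  fixes le :: "'w \<Rightarrow> 'w \<Rightarrow> bool" and acc :: "'w \<Rightarrow> 'w \<Rightarrow> bool"
  assumes le_refl: "le w w"
    and le_trans: "le w v \<Longrightarrow> le v u \<Longrightarrow> le w u"
    and le_connected: "le w v \<Longrightarrow> le w u \<Longrightarrow> le v u \<or> le u v"
    and acc_refl: "acc w w"
    and acc_trans: "acc w v \<Longrightarrow> acc v u \<Longrightarrow> acc w u"
    and forward_confluence: "le w v \<Longrightarrow> acc w u \<Longrightarrow> \<exists>z. acc v z \<and> le u z"
    and backward_confluence: "acc w v \<Longrightarrow> le v u \<Longrightarrow> \<exists>z. le w z \<and> acc z u"
begin

primrec sat :: "(nat \<Rightarrow> 'w \<Rightarrow> bool) \<Rightarrow> 'w \<Rightarrow> fm \<Rightarrow> bool" where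
  "sat V w (Var n) \<longleftrightarrow> V n w"
| "sat V w \<^bold>\<bottom> \<longleftrightarrow> False"
| "sat V w (\<phi> \<^bold>\<and> \<psi>) \<longleftrightarrow> sat V w \<phi> \<and> sat V w \<psi>"
| "sat V w (\<phi> \<^bold>\<or> \<psi>) \<longleftrightarrow> sat V w \<phi> \<or> sat V w \<psi>"
| "sat V w (\<phi> \<^bold>\<longrightarrow> \<psi>) \<longleftrightarrow> (\<forall>v. le w v \<longrightarrow> sat V v \<phi> \<longrightarrow> sat V v \<psi>)"
| "sat V w (\<^bold>\<diamond> \<phi>) \<longleftrightarrow> (\<exists>v. acc w v \<and> sat V v \<phi>)"
| "sat V w (\<^bold>\<box> \<phi>) \<longleftrightarrow> (\<forall>v u. le w v \<longrightarrow> acc v u \<longrightarrow> sat V u \<phi>)"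

definition persistent :: "(nat \<Rightarrow> 'w \<Rightarrow> bool) \<Rightarrow> bool" where
  "persistent V \<longleftrightarrow> (\<forall>n w v. le w v \<longrightarrow> V n w \<longrightarrow> V n v)"

section \<open>Persistence and soundness\<close>

definition valid :: "fm \<Rightarrow> bool" where
  "valid \<phi> \<longleftrightarrow> (\<forall>V w. persistent V \<longrightarrow> sat V w \<phi>)"

text \<open>Implication and \<open>Box\<close> look along \<open>le\<close> by definition, so
  transitivity suffices for them; \<open>Dia\<close> does not, and needs forward confluence.\<close>

lemma sat_mono:
  assumes "persistent V" shows "le w v \<Longrightarrow> sat V w \<phi> \<Longrightarrow> sat V v \<phi>"
proof (induction \<phi> arbitrary: w v)
  case (Var n)
  then show ?case using assms unfolding persistent_def by auto
next
  case (Impl \<phi> \<psi>)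
  then show ?case using le_trans by (meson sat.simps(5))
next
  case (Dia \<phi>)
  from \<open>sat V w (\<^bold>\<diamond> \<phi>)\<close> obtain u where "acc w u" "sat V u \<phi>" by auto
  with forward_confluence Dia.prems(1) Dia.IH show ?case by (meson sat.simps(6))
next
  case (Box \<phi>)
  then show ?case using le_trans by (meson sat.simps(7))
qed auto

lemma sat_subst: "sat V w (subst \<sigma> \<phi>) \<longleftrightarrow> sat (\<lambda>n v. sat V v (\<sigma> n)) w \<phi>"
  by (induction \<phi> arbitrary: w) auto

lemma valid_subst:
  assumes "valid \<phi>" shows "valid (subst \<sigma> \<phi>)"
  unfolding valid_def sat_subst
proof (intro allI impI)
  fix V w
  assume "persistent V"
  then have "persistent (\<lambda>n v. sat V v (\<sigma> n))" using sat_mono unfolding persistent_def by blast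
  with assms show "sat (\<lambda>n v. sat V v (\<sigma> n)) w \<phi>" unfolding valid_def by blast
qed

lemma valid_mp: "valid \<phi> \<Longrightarrow> valid (\<phi> \<^bold>\<longrightarrow> \<psi>) \<Longrightarrow> valid \<psi>"
  using le_refl unfolding valid_def by (meson sat.simps(5))

lemma valid_IPC: "\<phi> \<in> IPC \<Longrightarrow> valid \<phi>"
proof (induction rule: IPC.induct)
  case (mp \<phi> \<psi>)
  then show ?case using valid_mp by blast
next
  case (K \<phi> \<psi>)
  show ?case unfolding valid_def by (auto intro: sat_mono)
next
  case (S \<phi> \<psi> \<chi>)
  show ?case unfolding valid_def by simp (meson le_refl le_trans)
next
  case (conjI \<phi> \<psi>)
  show ?case unfolding valid_def by (auto intro: sat_mono)
next
  case (disjE \<phi> \<chi> \<psi>)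
  show ?case unfolding valid_def by simp (meson le_refl le_trans)
qed (auto simp: valid_def)

lemma valid_CS4_axioms: "\<phi> \<in> CS4_axioms \<Longrightarrow> valid \<phi>"
proof -
  have "valid (\<^bold>\<box> (\<phi> \<^bold>\<longrightarrow> \<psi>) \<^bold>\<longrightarrow> (\<^bold>\<box> \<phi> \<^bold>\<longrightarrow> \<^bold>\<box> \<psi>))" for \<phi> \<psi>
    unfolding valid_def by simp (meson le_refl le_trans)
  moreover have "valid (\<^bold>\<box> (\<phi> \<^bold>\<longrightarrow> \<psi>) \<^bold>\<longrightarrow> (\<^bold>\<diamond> \<phi> \<^bold>\<longrightarrow> \<^bold>\<diamond> \<psi>))" for \<phi> \<psi>
    unfolding valid_def by simp (meson le_refl)
  moreover have "valid (\<^bold>\<box> \<phi> \<^bold>\<longrightarrow> \<phi>)" for \<phi>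
    unfolding valid_def by simp (meson le_refl acc_refl)
  moreover have "valid (\<phi> \<^bold>\<longrightarrow> \<^bold>\<diamond> \<phi>)" for \<phi>
    unfolding valid_def by simp (meson acc_refl)
  moreover have "valid (\<^bold>\<diamond> \<^bold>\<diamond> \<phi> \<^bold>\<longrightarrow> \<^bold>\<diamond> \<phi>)" for \<phi>
    unfolding valid_def by simp (meson acc_trans)
  \<comment> \<open>A path \<open>le\<close>, \<open>acc\<close>, \<open>le\<close>,
    \<open>acc\<close> must become one \<open>le\<close> step and one \<open>acc\<close> step:
    backward confluence exchanges the middle pair.\<close>
  moreover have "valid (\<^bold>\<box> \<phi> \<^bold>\<longrightarrow> \<^bold>\<box> \<^bold>\<box> \<phi>)" for \<phi>
    unfolding valid_def by simp (meson backward_confluence le_trans acc_trans)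
  ultimately show "\<phi> \<in> CS4_axioms \<Longrightarrow> valid \<phi>" unfolding CS4_axioms_def Let_def by blast
qed

lemma valid_GS4_axioms: "\<phi> \<in> GS4_axioms \<Longrightarrow> valid \<phi>"
proof -
  have "valid (\<^bold>\<diamond> (\<phi> \<^bold>\<or> \<psi>) \<^bold>\<longrightarrow> \<^bold>\<diamond> \<phi> \<^bold>\<or> \<^bold>\<diamond> \<psi>)" for \<phi> \<psi>
    unfolding valid_def by auto
  moreover have "valid (\<^bold>\<not> \<^bold>\<diamond> \<^bold>\<bottom>)"
    unfolding valid_def by simp
  \<comment> \<open>If \<phi> holds at a world above an accessible one, backward confluence gives a
    world above the source that accesses it. There the diamond holds, hence the box, hence \<psi> at
    the target.\<close>
  moreover have "valid ((\<^bold>\<diamond> \<phi> \<^bold>\<longrightarrow> \<^bold>\<box> \<psi>) \<^bold>\<longrightarrow> \<^bold>\<box> (\<phi> \<^bold>\<longrightarrow> \<psi>))" for \<phi> \<psi>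
    unfolding valid_def by simp (meson backward_confluence le_refl le_trans)
  moreover have "valid ((\<phi> \<^bold>\<longrightarrow> \<psi>) \<^bold>\<or> (\<psi> \<^bold>\<longrightarrow> \<phi>))" for \<phi> \<psi>
    unfolding valid_def by simp (meson le_connected sat_mono)
  ultimately show "\<phi> \<in> GS4_axioms \<Longrightarrow> valid \<phi>" unfolding GS4_axioms_def Let_def by blast
qed

lemma valid_nec: "valid \<phi> \<Longrightarrow> valid (\<^bold>\<box> \<phi>)"
  unfolding valid_def by simp

theorem soundness: "\<phi> \<in> GS4 \<Longrightarrow> valid \<phi>"
proof -
  have closed: "is_logic {\<phi>. valid \<phi>}" "closed_mp {\<phi>. valid \<phi>}" "closed_nec {\<phi>. valid \<phi>}"
    unfolding is_logic_def closed_mp_def closed_nec_def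
    by (blast intro: valid_subst, blast intro: valid_mp, blast intro: valid_nec)
  have "CS4 \<subseteq> {\<phi>. valid \<phi>}"
    unfolding CS4_def by (rule Inter_lower) (use closed valid_IPC valid_CS4_axioms in auto)
  then have "GS4 \<subseteq> {\<phi>. valid \<phi>}"
    unfolding GS4_def by (intro Inter_lower) (use closed valid_GS4_axioms in auto)
  then show "\<phi> \<in> GS4 \<Longrightarrow> valid \<phi>" by blast
qed

end

section \<open>Prime theories\<close>

lemma GS4_closed: "is_logic GS4" "closed_mp GS4" "closed_nec GS4"
proof -
  show "is_logic GS4"
    unfolding is_logic_def GS4_def by blast
  show "closed_mp GS4"
    unfolding closed_mp_def GS4_def by blast
  show "closed_nec GS4"
    unfolding closed_nec_def GS4_def by blast
qed

lemma GS4_supersets: "IPC \<subseteq> GS4" "CS4_axioms \<subseteq> GS4" "GS4_axioms \<subseteq> GS4"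
  unfolding GS4_def CS4_def by blast+

text \<open>The axioms use only the variables 0 and 1, so a substitution that sends 0 to \<phi> and
  all others to \<psi> yields every instance.\<close>

lemma GS4_axiom_instance:
  assumes "\<chi> \<in> CS4_axioms \<union> GS4_axioms"
  shows "subst (case_nat \<phi> (\<lambda>_. \<psi>)) \<chi> \<in> GS4"
  using assms GS4_supersets GS4_closed(1) unfolding is_logic_def by blast

lemma GS4_axiom_schemes:
  "(\<^bold>\<box> (\<phi> \<^bold>\<longrightarrow> \<psi>) \<^bold>\<longrightarrow> (\<^bold>\<box> \<phi> \<^bold>\<longrightarrow> \<^bold>\<box> \<psi>)) \<in> GS4"
  "(\<^bold>\<box> (\<phi> \<^bold>\<longrightarrow> \<psi>) \<^bold>\<longrightarrow> (\<^bold>\<diamond> \<phi> \<^bold>\<longrightarrow> \<^bold>\<diamond> \<psi>)) \<in> GS4"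
  "(\<^bold>\<box> \<phi> \<^bold>\<longrightarrow> \<phi>) \<in> GS4"
  "(\<phi> \<^bold>\<longrightarrow> \<^bold>\<diamond> \<phi>) \<in> GS4"
  "(\<^bold>\<diamond> \<^bold>\<diamond> \<phi> \<^bold>\<longrightarrow> \<^bold>\<diamond> \<phi>) \<in> GS4"
  "(\<^bold>\<box> \<phi> \<^bold>\<longrightarrow> \<^bold>\<box> \<^bold>\<box> \<phi>) \<in> GS4"
  "(\<^bold>\<diamond> (\<phi> \<^bold>\<or> \<psi>) \<^bold>\<longrightarrow> \<^bold>\<diamond> \<phi> \<^bold>\<or> \<^bold>\<diamond> \<psi>) \<in> GS4"
  "(\<^bold>\<not> \<^bold>\<diamond> \<^bold>\<bottom>) \<in> GS4"
  "((\<^bold>\<diamond> \<phi> \<^bold>\<longrightarrow> \<^bold>\<box> \<psi>) \<^bold>\<longrightarrow> \<^bold>\<box> (\<phi> \<^bold>\<longrightarrow> \<psi>)) \<in> GS4"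
  "((\<phi> \<^bold>\<longrightarrow> \<psi>) \<^bold>\<or> (\<psi> \<^bold>\<longrightarrow> \<phi>)) \<in> GS4"
proof -
  let ?s = "subst (case_nat \<phi> (\<lambda>_. \<psi>))"
  have "?s ` (CS4_axioms \<union> GS4_axioms) \<subseteq> GS4" using GS4_axiom_instance by blast
  then show
  "(\<^bold>\<box> (\<phi> \<^bold>\<longrightarrow> \<psi>) \<^bold>\<longrightarrow> (\<^bold>\<box> \<phi> \<^bold>\<longrightarrow> \<^bold>\<box> \<psi>)) \<in> GS4"
  "(\<^bold>\<box> (\<phi> \<^bold>\<longrightarrow> \<psi>) \<^bold>\<longrightarrow> (\<^bold>\<diamond> \<phi> \<^bold>\<longrightarrow> \<^bold>\<diamond> \<psi>)) \<in> GS4"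
  "(\<^bold>\<box> \<phi> \<^bold>\<longrightarrow> \<phi>) \<in> GS4"
  "(\<phi> \<^bold>\<longrightarrow> \<^bold>\<diamond> \<phi>) \<in> GS4"
  "(\<^bold>\<diamond> \<^bold>\<diamond> \<phi> \<^bold>\<longrightarrow> \<^bold>\<diamond> \<phi>) \<in> GS4"
  "(\<^bold>\<box> \<phi> \<^bold>\<longrightarrow> \<^bold>\<box> \<^bold>\<box> \<phi>) \<in> GS4"
  "(\<^bold>\<diamond> (\<phi> \<^bold>\<or> \<psi>) \<^bold>\<longrightarrow> \<^bold>\<diamond> \<phi> \<^bold>\<or> \<^bold>\<diamond> \<psi>) \<in> GS4"
  "(\<^bold>\<not> \<^bold>\<diamond> \<^bold>\<bottom>) \<in> GS4"
  "((\<^bold>\<diamond> \<phi> \<^bold>\<longrightarrow> \<^bold>\<box> \<psi>) \<^bold>\<longrightarrow> \<^bold>\<box> (\<phi> \<^bold>\<longrightarrow> \<psi>)) \<in> GS4"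
  "((\<phi> \<^bold>\<longrightarrow> \<psi>) \<^bold>\<or> (\<psi> \<^bold>\<longrightarrow> \<phi>)) \<in> GS4"
    unfolding CS4_axioms_def GS4_axioms_def Let_def by simp_all
qed

text \<open>Closure is under local consequence only: a world may contain a formula without its
  box.\<close>

definition gs4_theory :: "fm set \<Rightarrow> bool" where
  "gs4_theory \<Gamma> \<longleftrightarrow> GS4 \<subseteq> \<Gamma> \<and> closed_mp \<Gamma>"

lemma theoryI:
  "GS4 \<subseteq> \<Gamma> \<Longrightarrow> (\<And>\<phi> \<psi>. \<phi> \<in> \<Gamma> \<Longrightarrow> (\<phi> \<^bold>\<longrightarrow> \<psi>) \<in> \<Gamma> \<Longrightarrow> \<psi> \<in> \<Gamma>) \<Longrightarrow> gs4_theory \<Gamma>"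
  unfolding gs4_theory_def closed_mp_def by blast

lemma theory_mp: "gs4_theory \<Gamma> \<Longrightarrow> (\<phi> \<^bold>\<longrightarrow> \<psi>) \<in> \<Gamma> \<Longrightarrow> \<phi> \<in> \<Gamma> \<Longrightarrow> \<psi> \<in> \<Gamma>"
  unfolding gs4_theory_def closed_mp_def by blast

lemma theory_GS4: "gs4_theory \<Gamma> \<Longrightarrow> \<phi> \<in> GS4 \<Longrightarrow> \<phi> \<in> \<Gamma>"
  unfolding gs4_theory_def by blast

lemma theory_GS4_mp: "gs4_theory \<Gamma> \<Longrightarrow> (\<phi> \<^bold>\<longrightarrow> \<psi>) \<in> GS4 \<Longrightarrow> \<phi> \<in> \<Gamma> \<Longrightarrow> \<psi> \<in> \<Gamma>"
  using theory_mp theory_GS4 by blast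

lemma theory_IPC: "gs4_theory \<Gamma> \<Longrightarrow> \<phi> \<in> IPC \<Longrightarrow> \<phi> \<in> \<Gamma>"
  unfolding gs4_theory_def using GS4_supersets by blast

lemma theory_of_GS4: "gs4_theory GS4"
  unfolding gs4_theory_def using GS4_closed by simp

section \<open>Intuitionistic and modal reasoning inside a theory\<close>

lemma theory_const: "gs4_theory \<Gamma> \<Longrightarrow> \<psi> \<in> \<Gamma> \<Longrightarrow> (\<phi> \<^bold>\<longrightarrow> \<psi>) \<in> \<Gamma>"
  using theory_mp theory_IPC IPC.K by blast

lemma theory_extend: assumes "gs4_theory \<Gamma>" shows "gs4_theory {\<chi>. (\<phi> \<^bold>\<longrightarrow> \<chi>) \<in> \<Gamma>}"
proof (intro theoryI subsetI CollectI)
  fix \<chi>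
  assume "\<chi> \<in> GS4"
  then show "(\<phi> \<^bold>\<longrightarrow> \<chi>) \<in> \<Gamma>" using assms theory_const theory_GS4 by blast
next
  fix \<chi> \<psi>
  assume "\<chi> \<in> {\<chi>. (\<phi> \<^bold>\<longrightarrow> \<chi>) \<in> \<Gamma>}" "(\<chi> \<^bold>\<longrightarrow> \<psi>) \<in> {\<chi>. (\<phi> \<^bold>\<longrightarrow> \<chi>) \<in> \<Gamma>}"
  then show "(\<phi> \<^bold>\<longrightarrow> \<psi>) \<in> \<Gamma>"
    using assms theory_mp theory_IPC IPC.S by (metis mem_Collect_eq)
qed

lemma theory_id: "gs4_theory \<Gamma> \<Longrightarrow> (\<phi> \<^bold>\<longrightarrow> \<phi>) \<in> \<Gamma>"
  using theory_mp theory_IPC IPC.K IPC.S by meson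

lemma deduction:
  assumes "gs4_theory \<Gamma>"
    and "\<And>\<Delta>. gs4_theory \<Delta> \<Longrightarrow> \<Gamma> \<subseteq> \<Delta> \<Longrightarrow> \<phi> \<in> \<Delta> \<Longrightarrow> \<psi> \<in> \<Delta>"
  shows "(\<phi> \<^bold>\<longrightarrow> \<psi>) \<in> \<Gamma>"
  using assms(2)[OF theory_extend[OF assms(1)]] theory_id theory_const assms(1) by blast

lemma theory_conj: "gs4_theory \<Gamma> \<Longrightarrow> \<phi> \<^bold>\<and> \<psi> \<in> \<Gamma> \<longleftrightarrow> \<phi> \<in> \<Gamma> \<and> \<psi> \<in> \<Gamma>"
  using theory_mp theory_IPC IPC.conjE1 IPC.conjE2 IPC.conjI by meson

lemma theory_disjI:
  "gs4_theory \<Gamma> \<Longrightarrow> \<phi> \<in> \<Gamma> \<Longrightarrow> \<phi> \<^bold>\<or> \<psi> \<in> \<Gamma>"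
  "gs4_theory \<Gamma> \<Longrightarrow> \<psi> \<in> \<Gamma> \<Longrightarrow> \<phi> \<^bold>\<or> \<psi> \<in> \<Gamma>"
  using theory_mp theory_IPC IPC.disjI1 IPC.disjI2 by meson+

lemma theory_disjE:
  "gs4_theory \<Gamma> \<Longrightarrow> \<phi> \<^bold>\<or> \<psi> \<in> \<Gamma> \<Longrightarrow> (\<phi> \<^bold>\<longrightarrow> \<chi>) \<in> \<Gamma> \<Longrightarrow> (\<psi> \<^bold>\<longrightarrow> \<chi>) \<in> \<Gamma> \<Longrightarrow> \<chi> \<in> \<Gamma>"
  using theory_mp theory_IPC IPC.disjE by meson

lemma theory_imp_trans:
  "gs4_theory \<Gamma> \<Longrightarrow> (\<phi> \<^bold>\<longrightarrow> \<psi>) \<in> \<Gamma> \<Longrightarrow> (\<psi> \<^bold>\<longrightarrow> \<chi>) \<in> \<Gamma> \<Longrightarrow> (\<phi> \<^bold>\<longrightarrow> \<chi>) \<in> \<Gamma>"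
  by (rule deduction) (blast intro: theory_mp)+

lemma theory_box: assumes "gs4_theory \<Gamma>" shows "gs4_theory {\<phi>. \<^bold>\<box> \<phi> \<in> \<Gamma>}"
proof (intro theoryI subsetI CollectI)
  fix \<phi>
  assume "\<phi> \<in> GS4"
  then show "\<^bold>\<box> \<phi> \<in> \<Gamma>" using GS4_closed(3) assms theory_GS4 unfolding closed_nec_def by blast
next
  fix \<phi> \<psi>
  assume "\<phi> \<in> {\<phi>. \<^bold>\<box> \<phi> \<in> \<Gamma>}" "(\<phi> \<^bold>\<longrightarrow> \<psi>) \<in> {\<phi>. \<^bold>\<box> \<phi> \<in> \<Gamma>}"
  then show "\<^bold>\<box> \<psi> \<in> \<Gamma>" using assms theory_GS4_mp[OF _ GS4_axiom_schemes(1)] theory_mp by blast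
qed

lemma theory_dia_mono:
  "gs4_theory \<Gamma> \<Longrightarrow> \<^bold>\<box> (\<phi> \<^bold>\<longrightarrow> \<psi>) \<in> \<Gamma> \<Longrightarrow> \<^bold>\<diamond> \<phi> \<in> \<Gamma> \<Longrightarrow> \<^bold>\<diamond> \<psi> \<in> \<Gamma>"
  using theory_GS4_mp[OF _ GS4_axiom_schemes(2)] theory_mp by blast

lemma theory_dia_GS4_mono:
  "gs4_theory \<Gamma> \<Longrightarrow> (\<phi> \<^bold>\<longrightarrow> \<psi>) \<in> GS4 \<Longrightarrow> \<^bold>\<diamond> \<phi> \<in> \<Gamma> \<Longrightarrow> \<^bold>\<diamond> \<psi> \<in> \<Gamma>"
  using theory_dia_mono theory_GS4 theory_box by blast

lemma GS4_box_mono: "(\<phi> \<^bold>\<longrightarrow> \<psi>) \<in> GS4 \<Longrightarrow> (\<^bold>\<box> \<phi> \<^bold>\<longrightarrow> \<^bold>\<box> \<psi>) \<in> GS4"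
  using theory_of_GS4 GS4_closed(3) theory_mp[OF theory_of_GS4 GS4_axiom_schemes(1)]
  unfolding closed_nec_def by blast

section \<open>Prime theories and their existence\<close>

definition prime :: "fm set \<Rightarrow> bool" where
  "prime \<Gamma> \<longleftrightarrow> gs4_theory \<Gamma> \<and> \<^bold>\<bottom> \<notin> \<Gamma> \<and> (\<forall>\<phi> \<psi>. \<phi> \<^bold>\<or> \<psi> \<in> \<Gamma> \<longrightarrow> \<phi> \<in> \<Gamma> \<or> \<psi> \<in> \<Gamma>)"

lemma prime_theory: "prime \<Gamma> \<Longrightarrow> gs4_theory \<Gamma>"
  unfolding prime_def by blast

lemma prime_disj: "prime \<Gamma> \<Longrightarrow> \<phi> \<^bold>\<or> \<psi> \<in> \<Gamma> \<longleftrightarrow> \<phi> \<in> \<Gamma> \<or> \<psi> \<in> \<Gamma>"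
  unfolding prime_def using theory_disjI by blast

text \<open>Avoiding a directed set instead of one formula replaces the usual pairs of accepted and
  rejected sets. If both disjuncts imply members of \<open>B\<close>, then both imply a common
  member, so a maximal theory avoiding \<open>B\<close> is prime; \<open>B\<close> being nonempty
  makes it consistent.\<close>

lemma prime_extension:
  assumes \<Gamma>: "gs4_theory \<Gamma>"
    and disjoint: "\<Gamma> \<inter> B = {}" and "B \<noteq> {}"
    and directed: "\<And>\<phi> \<psi>. \<phi> \<in> B \<Longrightarrow> \<psi> \<in> B \<Longrightarrow>
      \<exists>\<chi>\<in>B. (\<phi> \<^bold>\<longrightarrow> \<chi>) \<in> GS4 \<and> (\<psi> \<^bold>\<longrightarrow> \<chi>) \<in> GS4"
  obtains \<Delta> where "prime \<Delta>" "\<Gamma> \<subseteq> \<Delta>" "\<Delta> \<inter> B = {}"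
proof -
  let ?S = "{\<Delta>. gs4_theory \<Delta> \<and> \<Gamma> \<subseteq> \<Delta> \<and> \<Delta> \<inter> B = {}}"
  have "\<exists>U\<in>?S. \<forall>X\<in>C. X \<subseteq> U" if C: "subset.chain ?S C" for C
  proof (cases "C = {}")
    case True
    then show ?thesis using assms by blast
  next
    case False
    then obtain X where "X \<in> C" by blast
    have mem: "gs4_theory Y \<and> \<Gamma> \<subseteq> Y \<and> Y \<inter> B = {}" if "Y \<in> C" for Y
      using C that unfolding subset_chain_def by blast
    have "gs4_theory (\<Union>C)"
    proof (rule theoryI)
      show "GS4 \<subseteq> \<Union>C" using \<open>X \<in> C\<close> mem unfolding gs4_theory_def by blast
      fix \<phi> \<psi>
      assume "\<phi> \<in> \<Union>C" "(\<phi> \<^bold>\<longrightarrow> \<psi>) \<in> \<Union>C"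
      then obtain Y Z where "Y \<in> C" "\<phi> \<in> Y" "Z \<in> C" "(\<phi> \<^bold>\<longrightarrow> \<psi>) \<in> Z" by blast
      moreover from this have "Y \<subseteq> Z \<or> Z \<subseteq> Y" using C unfolding subset_chain_def by blast
      ultimately obtain W where "W \<in> C" "\<phi> \<in> W" "(\<phi> \<^bold>\<longrightarrow> \<psi>) \<in> W" by blast
      then show "\<psi> \<in> \<Union>C" using mem theory_mp by blast
    qed
    moreover have "\<Gamma> \<subseteq> \<Union>C" using mem[OF \<open>X \<in> C\<close>] \<open>X \<in> C\<close> by blast
    moreover have "\<Union>C \<inter> B = {}" using mem by blast
    ultimately show ?thesis by blast
  qed
  from subset_Zorn[OF this] obtain M
    where M: "gs4_theory M" "\<Gamma> \<subseteq> M" "M \<inter> B = {}"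
      and max: "\<And>X. gs4_theory X \<Longrightarrow> M \<subseteq> X \<Longrightarrow> X \<inter> B = {} \<Longrightarrow> X = M"
    by (auto dest: order_trans)
  \<comment> \<open>Otherwise the theory generated by \<open>M\<close> and \<phi> would still avoid
    \<open>B\<close>, so by maximality it would be \<open>M\<close>, although it contains
    \<phi>.\<close>
  have meets: "\<exists>\<beta>\<in>B. (\<phi> \<^bold>\<longrightarrow> \<beta>) \<in> M" if "\<phi> \<notin> M" for \<phi>
  proof (rule ccontr)
    assume "\<not> ?thesis"
    then have "{\<chi>. (\<phi> \<^bold>\<longrightarrow> \<chi>) \<in> M} = M"
      by (intro max theory_extend M) (use theory_const M in blast)+
    then show False using that theory_id[OF M(1)] by blast
  qed
  have "\<phi> \<in> M \<or> \<psi> \<in> M" if "\<phi> \<^bold>\<or> \<psi> \<in> M" for \<phi> \<psi>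
  proof (rule ccontr)
    assume "\<not> ?thesis"
    then obtain \<beta> \<gamma> where "\<beta> \<in> B" "(\<phi> \<^bold>\<longrightarrow> \<beta>) \<in> M" "\<gamma> \<in> B" "(\<psi> \<^bold>\<longrightarrow> \<gamma>) \<in> M"
      using meets by blast
    moreover from this directed obtain \<chi>
      where "\<chi> \<in> B" "(\<beta> \<^bold>\<longrightarrow> \<chi>) \<in> GS4" "(\<gamma> \<^bold>\<longrightarrow> \<chi>) \<in> GS4" by blast
    ultimately have "\<chi> \<in> M" using that M(1)
      by (meson theory_disjE theory_imp_trans theory_GS4)
    with \<open>\<chi> \<in> B\<close> M(3) show False by blast
  qed
  moreover have "\<^bold>\<bottom> \<notin> M"
  proof
    assume "\<^bold>\<bottom> \<in> M"
    then have "B \<subseteq> M" using theory_mp[OF M(1)] theory_IPC[OF M(1) IPC.botE] by blast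
    then show False using \<open>B \<noteq> {}\<close> M(3) by blast
  qed
  ultimately have "prime M" using M(1) unfolding prime_def by blast
  then show ?thesis using that M by blast
qed

lemma prime_avoiding:
  assumes "gs4_theory \<Gamma>" "\<psi> \<notin> \<Gamma>"
  obtains \<Delta> where "prime \<Delta>" "\<Gamma> \<subseteq> \<Delta>" "\<psi> \<notin> \<Delta>"
proof (rule prime_extension[of \<Gamma> "{\<psi>}"])
  show "\<exists>\<chi>\<in>{\<psi>}. (\<phi> \<^bold>\<longrightarrow> \<chi>) \<in> GS4 \<and> (\<phi>' \<^bold>\<longrightarrow> \<chi>) \<in> GS4"
    if "\<phi> \<in> {\<psi>}" "\<phi>' \<in> {\<psi>}" for \<phi> \<phi>'
    using that theory_id[OF theory_of_GS4] by blast
qed (use assms that in auto)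

section \<open>The canonical model\<close>

lemma prime_connected:
  assumes "prime \<Gamma>" "prime \<Delta>" "prime \<Theta>" "\<Gamma> \<subseteq> \<Delta>" "\<Gamma> \<subseteq> \<Theta>"
  shows "\<Delta> \<subseteq> \<Theta> \<or> \<Theta> \<subseteq> \<Delta>"
proof (rule ccontr)
  assume "\<not> ?thesis"
  then obtain \<phi> \<psi> where *: "\<phi> \<in> \<Delta>" "\<phi> \<notin> \<Theta>" "\<psi> \<in> \<Theta>" "\<psi> \<notin> \<Delta>" by blast
  have "(\<phi> \<^bold>\<longrightarrow> \<psi>) \<in> \<Gamma> \<or> (\<psi> \<^bold>\<longrightarrow> \<phi>) \<in> \<Gamma>"
    using assms(1) prime_disj prime_theory theory_GS4 GS4_axiom_schemes(10) by blast
  then show False using * assms theory_mp prime_theory by blast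
qed

text \<open>Both inclusions are imposed, since over an intuitionistic base there is no classical
  duality to derive one from the other.\<close>

definition can_acc :: "fm set \<Rightarrow> fm set \<Rightarrow> bool" where
  "can_acc \<Gamma> \<Delta> \<longleftrightarrow> {\<phi>. \<^bold>\<box> \<phi> \<in> \<Gamma>} \<subseteq> \<Delta> \<and> \<Delta> \<subseteq> {\<phi>. \<^bold>\<diamond> \<phi> \<in> \<Gamma>}"

text \<open>The formulas to avoid are those whose diamond is not in \<Gamma>. Two of them have their
  disjunction as an upper bound, because \<open>Dia\<close> distributes over disjunction and
  \<Gamma> is prime; \<open>Bot\<close> is one of them.\<close>

lemma dia_successor:
  assumes \<Gamma>: "prime \<Gamma>" and \<Theta>: "gs4_theory \<Theta>" "{\<phi>. \<^bold>\<box> \<phi> \<in> \<Gamma>} \<subseteq> \<Theta>" "\<Theta> \<subseteq> {\<phi>. \<^bold>\<diamond> \<phi> \<in> \<Gamma>}"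
  obtains \<Delta> where "prime \<Delta>" "\<Theta> \<subseteq> \<Delta>" "can_acc \<Gamma> \<Delta>"
proof (rule prime_extension[OF \<Theta>(1), of "{\<chi>. \<^bold>\<diamond> \<chi> \<notin> \<Gamma>}"])
  note th = prime_theory[OF \<Gamma>]
  show "\<Theta> \<inter> {\<chi>. \<^bold>\<diamond> \<chi> \<notin> \<Gamma>} = {}" using \<Theta>(3) by blast
  have "\<^bold>\<diamond> \<^bold>\<bottom> \<notin> \<Gamma>"
    using \<Gamma> theory_GS4_mp[OF th GS4_axiom_schemes(8)] unfolding prime_def by blast
  then show "{\<chi>. \<^bold>\<diamond> \<chi> \<notin> \<Gamma>} \<noteq> {}" by blast
  fix \<phi> \<psi>
  assume "\<phi> \<in> {\<chi>. \<^bold>\<diamond> \<chi> \<notin> \<Gamma>}" "\<psi> \<in> {\<chi>. \<^bold>\<diamond> \<chi> \<notin> \<Gamma>}"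
  then have "\<^bold>\<diamond> (\<phi> \<^bold>\<or> \<psi>) \<notin> \<Gamma>"
    using prime_disj[OF \<Gamma>] theory_GS4_mp[OF th GS4_axiom_schemes(7)] by blast
  then show "\<exists>\<chi>\<in>{\<chi>. \<^bold>\<diamond> \<chi> \<notin> \<Gamma>}. (\<phi> \<^bold>\<longrightarrow> \<chi>) \<in> GS4 \<and> (\<psi> \<^bold>\<longrightarrow> \<chi>) \<in> GS4"
    using GS4_supersets(1) IPC.disjI1 IPC.disjI2 by blast
next
  fix \<Delta>
  assume "prime \<Delta>" "\<Theta> \<subseteq> \<Delta>" "\<Delta> \<inter> {\<chi>. \<^bold>\<diamond> \<chi> \<notin> \<Gamma>} = {}"
  then show thesis using that \<Theta>(2) unfolding can_acc_def by blast
qed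

lemma can_dia:
  assumes "prime \<Gamma>" "\<^bold>\<diamond> \<phi> \<in> \<Gamma>"
  obtains \<Delta> where "prime \<Delta>" "can_acc \<Gamma> \<Delta>" "\<phi> \<in> \<Delta>"
proof -
  note th = prime_theory[OF assms(1)] and box = theory_box[OF prime_theory[OF assms(1)]]
  \<comment> \<open>The theory generated by \<phi> and the formulas boxed in \<Gamma>.\<close>
  let ?\<Theta> = "{\<chi>. (\<phi> \<^bold>\<longrightarrow> \<chi>) \<in> {\<chi>. \<^bold>\<box> \<chi> \<in> \<Gamma>}}"
  have "{\<chi>. \<^bold>\<box> \<chi> \<in> \<Gamma>} \<subseteq> ?\<Theta>" using theory_const[OF box] by blast
  moreover have "?\<Theta> \<subseteq> {\<chi>. \<^bold>\<diamond> \<chi> \<in> \<Gamma>}" using theory_dia_mono[OF th] assms(2) by blast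
  ultimately obtain \<Delta> where "prime \<Delta>" "?\<Theta> \<subseteq> \<Delta>" "can_acc \<Gamma> \<Delta>"
    by (rule dia_successor[OF assms(1) theory_extend[OF box]])
  then show ?thesis using that theory_id[OF box] by blast
qed

lemma can_forward:
  assumes "prime \<Gamma>" "prime \<Gamma>'" "prime \<Delta>" "\<Gamma> \<subseteq> \<Gamma>'" "can_acc \<Gamma> \<Delta>"
  obtains \<Delta>' where "prime \<Delta>'" "\<Delta> \<subseteq> \<Delta>'" "can_acc \<Gamma>' \<Delta>'"
proof -
  note th = prime_theory[OF assms(2)] and box = theory_box[OF prime_theory[OF assms(2)]]
    and th\<Delta> = prime_theory[OF assms(3)]
  \<comment> \<open>The theory generated by \<Delta> and the formulas boxed in
    \<open>\<Gamma>'\<close>. A single \<delta> suffices as hypothesis, since \<Delta> is closed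
    under conjunction.\<close>
  let ?\<Theta> = "{\<chi>. \<exists>\<delta>\<in>\<Delta>. \<^bold>\<box> (\<delta> \<^bold>\<longrightarrow> \<chi>) \<in> \<Gamma>'}"
  have \<Delta>: "\<Delta> \<subseteq> ?\<Theta>" using theory_id[OF box] by blast
  have box_sub: "{\<chi>. \<^bold>\<box> \<chi> \<in> \<Gamma>'} \<subseteq> ?\<Theta>"
    using theory_const[OF box] theory_id[OF th\<Delta>] by blast
  have "gs4_theory ?\<Theta>"
  proof (rule theoryI)
    show "GS4 \<subseteq> ?\<Theta>" using \<Delta> th\<Delta> unfolding gs4_theory_def by blast
    fix \<phi> \<psi>
    assume "\<phi> \<in> ?\<Theta>" "(\<phi> \<^bold>\<longrightarrow> \<psi>) \<in> ?\<Theta>"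
    then obtain \<delta> \<epsilon> where \<delta>: "\<delta> \<in> \<Delta>" "\<^bold>\<box> (\<delta> \<^bold>\<longrightarrow> \<phi>) \<in> \<Gamma>'"
      and \<epsilon>: "\<epsilon> \<in> \<Delta>" "\<^bold>\<box> (\<epsilon> \<^bold>\<longrightarrow> \<phi> \<^bold>\<longrightarrow> \<psi>) \<in> \<Gamma>'" by blast
    have "\<delta> \<^bold>\<and> \<epsilon> \<in> \<Delta>" using \<delta> \<epsilon> theory_conj[OF th\<Delta>] by blast
    moreover have "(\<delta> \<^bold>\<and> \<epsilon> \<^bold>\<longrightarrow> \<psi>) \<in> {\<chi>. \<^bold>\<box> \<chi> \<in> \<Gamma>'}"
    proof (rule deduction[OF box])
      fix \<Xi>
      assume \<Xi>: "gs4_theory \<Xi>" "{\<chi>. \<^bold>\<box> \<chi> \<in> \<Gamma>'} \<subseteq> \<Xi>" "\<delta> \<^bold>\<and> \<epsilon> \<in> \<Xi>"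
      then have "\<delta> \<in> \<Xi>" "\<epsilon> \<in> \<Xi>" using theory_conj by blast+
      moreover have "(\<delta> \<^bold>\<longrightarrow> \<phi>) \<in> \<Xi>" "(\<epsilon> \<^bold>\<longrightarrow> \<phi> \<^bold>\<longrightarrow> \<psi>) \<in> \<Xi>" using \<Xi>(2) \<delta> \<epsilon> by blast+
      ultimately show "\<psi> \<in> \<Xi>" using theory_mp[OF \<Xi>(1)] by blast
    qed
    ultimately show "\<psi> \<in> ?\<Theta>" by blast
  qed
  moreover have "?\<Theta> \<subseteq> {\<chi>. \<^bold>\<diamond> \<chi> \<in> \<Gamma>'}"
    using theory_dia_mono[OF th] assms(4,5) unfolding can_acc_def by blast
  ultimately obtain \<Delta>' where "prime \<Delta>'" "?\<Theta> \<subseteq> \<Delta>'" "can_acc \<Gamma>' \<Delta>'"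
    using dia_successor[OF assms(2) _ box_sub] by blast
  then show ?thesis using that \<Delta> by blast
qed

text \<open>Add the diamonds of \<Delta> to \<Gamma> and avoid the boxes of formulas outside
  \<Delta>. If \<open>Dia \<delta>\<close> implied such a \<open>Box \<chi>\<close> in \<Gamma>,
  then \<open>Box (\<delta> \<longrightarrow> \<chi>)\<close> would be in \<Gamma> and \<chi> in
  \<Delta>. Only the box half of accessibility is assumed; the diamond half is created by enlarging
  \<Gamma>.\<close>

lemma can_backward:
  assumes "gs4_theory \<Gamma>" "prime \<Delta>" "{\<phi>. \<^bold>\<box> \<phi> \<in> \<Gamma>} \<subseteq> \<Delta>"
  obtains \<Gamma>' where "prime \<Gamma>'" "\<Gamma> \<subseteq> \<Gamma>'" "can_acc \<Gamma>' \<Delta>"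
proof -
  note th = prime_theory[OF assms(2)]
  let ?\<Theta> = "{\<chi>. \<exists>\<delta>\<in>\<Delta>. (\<^bold>\<diamond> \<delta> \<^bold>\<longrightarrow> \<chi>) \<in> \<Gamma>}" and ?B = "{\<^bold>\<box> \<chi> |\<chi>. \<chi> \<notin> \<Delta>}"
  have \<Gamma>: "\<Gamma> \<subseteq> ?\<Theta>" using theory_const[OF assms(1)] theory_id[OF th] by blast
  have "gs4_theory ?\<Theta>"
  proof (rule theoryI)
    show "GS4 \<subseteq> ?\<Theta>" using \<Gamma> assms(1) unfolding gs4_theory_def by blast
    fix \<phi> \<psi>
    assume "\<phi> \<in> ?\<Theta>" "(\<phi> \<^bold>\<longrightarrow> \<psi>) \<in> ?\<Theta>"
    then obtain \<delta> \<epsilon> where \<delta>: "\<delta> \<in> \<Delta>" "(\<^bold>\<diamond> \<delta> \<^bold>\<longrightarrow> \<phi>) \<in> \<Gamma>"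
      and \<epsilon>: "\<epsilon> \<in> \<Delta>" "(\<^bold>\<diamond> \<epsilon> \<^bold>\<longrightarrow> \<phi> \<^bold>\<longrightarrow> \<psi>) \<in> \<Gamma>" by blast
    have "\<delta> \<^bold>\<and> \<epsilon> \<in> \<Delta>" using \<delta> \<epsilon> theory_conj[OF th] by blast
    moreover have "(\<^bold>\<diamond> (\<delta> \<^bold>\<and> \<epsilon>) \<^bold>\<longrightarrow> \<psi>) \<in> \<Gamma>"
    proof (rule deduction[OF assms(1)])
      fix \<Xi>
      assume \<Xi>: "gs4_theory \<Xi>" "\<Gamma> \<subseteq> \<Xi>" "\<^bold>\<diamond> (\<delta> \<^bold>\<and> \<epsilon>) \<in> \<Xi>"
      have "\<^bold>\<diamond> \<delta> \<in> \<Xi>" "\<^bold>\<diamond> \<epsilon> \<in> \<Xi>"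
        using \<Xi> theory_dia_GS4_mono GS4_supersets(1) IPC.conjE1 IPC.conjE2 by blast+
      moreover have "(\<^bold>\<diamond> \<delta> \<^bold>\<longrightarrow> \<phi>) \<in> \<Xi>" "(\<^bold>\<diamond> \<epsilon> \<^bold>\<longrightarrow> \<phi> \<^bold>\<longrightarrow> \<psi>) \<in> \<Xi>" using \<Xi>(2) \<delta> \<epsilon> by blast+
      ultimately show "\<psi> \<in> \<Xi>" using theory_mp[OF \<Xi>(1)] by blast
    qed
    ultimately show "\<psi> \<in> ?\<Theta>" by blast
  qed
  moreover have "?\<Theta> \<inter> ?B = {}"
  proof -
    have "\<chi> \<in> \<Delta>" if "\<delta> \<in> \<Delta>" "(\<^bold>\<diamond> \<delta> \<^bold>\<longrightarrow> \<^bold>\<box> \<chi>) \<in> \<Gamma>" for \<delta> \<chi>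
      using that assms(3) theory_GS4_mp[OF assms(1) GS4_axiom_schemes(9)] theory_mp[OF th] by blast
    then show ?thesis by blast
  qed
  moreover have "?B \<noteq> {}" using assms(2) unfolding prime_def by blast
  moreover have "\<exists>\<chi>\<in>?B. (\<phi> \<^bold>\<longrightarrow> \<chi>) \<in> GS4 \<and> (\<psi> \<^bold>\<longrightarrow> \<chi>) \<in> GS4" if B: "\<phi> \<in> ?B" "\<psi> \<in> ?B" for \<phi> \<psi>
  proof -
    obtain \<alpha> \<beta> where *: "\<phi> = \<^bold>\<box> \<alpha>" "\<psi> = \<^bold>\<box> \<beta>" "\<alpha> \<notin> \<Delta>" "\<beta> \<notin> \<Delta>" using B by blast
    then have "\<^bold>\<box> (\<alpha> \<^bold>\<or> \<beta>) \<in> ?B" using prime_disj[OF assms(2)] by blast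
    moreover have "(\<phi> \<^bold>\<longrightarrow> \<^bold>\<box> (\<alpha> \<^bold>\<or> \<beta>)) \<in> GS4" "(\<psi> \<^bold>\<longrightarrow> \<^bold>\<box> (\<alpha> \<^bold>\<or> \<beta>)) \<in> GS4"
      using * GS4_box_mono GS4_supersets(1) IPC.disjI1 IPC.disjI2 by blast+
    ultimately show ?thesis by blast
  qed
  ultimately obtain \<Gamma>' where \<Gamma>': "prime \<Gamma>'" "?\<Theta> \<subseteq> \<Gamma>'" "\<Gamma>' \<inter> ?B = {}"
    by (rule prime_extension[of ?\<Theta> ?B])
  moreover have "\<^bold>\<diamond> \<delta> \<in> \<Gamma>'" if "\<delta> \<in> \<Delta>" for \<delta>
    using that theory_id[OF assms(1)] \<Gamma>'(2) by blast
  ultimately have "can_acc \<Gamma>' \<Delta>" unfolding can_acc_def by blast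
  then show ?thesis using that \<Gamma> \<Gamma>' by blast
qed

lemma can_imp:
  assumes "prime \<Gamma>"
  shows "(\<phi> \<^bold>\<longrightarrow> \<psi>) \<in> \<Gamma> \<longleftrightarrow> (\<forall>\<Delta>. prime \<Delta> \<longrightarrow> \<Gamma> \<subseteq> \<Delta> \<longrightarrow> \<phi> \<in> \<Delta> \<longrightarrow> \<psi> \<in> \<Delta>)"
proof
  assume "(\<phi> \<^bold>\<longrightarrow> \<psi>) \<in> \<Gamma>"
  then show "\<forall>\<Delta>. prime \<Delta> \<longrightarrow> \<Gamma> \<subseteq> \<Delta> \<longrightarrow> \<phi> \<in> \<Delta> \<longrightarrow> \<psi> \<in> \<Delta>"
    using theory_mp prime_theory by blast
next
  assume *: "\<forall>\<Delta>. prime \<Delta> \<longrightarrow> \<Gamma> \<subseteq> \<Delta> \<longrightarrow> \<phi> \<in> \<Delta> \<longrightarrow> \<psi> \<in> \<Delta>"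
  note th = prime_theory[OF assms]
  show "(\<phi> \<^bold>\<longrightarrow> \<psi>) \<in> \<Gamma>"
  proof (rule ccontr)
    assume "(\<phi> \<^bold>\<longrightarrow> \<psi>) \<notin> \<Gamma>"
    then obtain \<Delta> where "prime \<Delta>" "{\<chi>. (\<phi> \<^bold>\<longrightarrow> \<chi>) \<in> \<Gamma>} \<subseteq> \<Delta>" "\<psi> \<notin> \<Delta>"
      using prime_avoiding[OF theory_extend[OF th, of \<phi>], of \<psi>] by blast
    then show False using * theory_const[OF th] theory_id[OF th] by blast
  qed
qed

text \<open>A prime theory that contains the formulas boxed in \<Gamma> and omits \<phi> need not
  satisfy the diamond half of \<open>can_acc\<close> from \<Gamma>; \<open>can_backward\<close>
  repairs this above \<Gamma>. Hence \<open>Box\<close> is evaluated along \<open>le\<close> and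
  then \<open>acc\<close>.\<close>

lemma can_box:
  assumes "prime \<Gamma>" "\<^bold>\<box> \<phi> \<notin> \<Gamma>"
  obtains \<Gamma>' \<Delta> where "prime \<Gamma>'" "prime \<Delta>" "\<Gamma> \<subseteq> \<Gamma>'" "can_acc \<Gamma>' \<Delta>" "\<phi> \<notin> \<Delta>"
proof -
  note th = prime_theory[OF assms(1)]
  obtain \<Delta> where \<Delta>: "prime \<Delta>" "{\<chi>. \<^bold>\<box> \<chi> \<in> \<Gamma>} \<subseteq> \<Delta>" "\<phi> \<notin> \<Delta>"
    using prime_avoiding[OF theory_box[OF th], of \<phi>] assms(2) by blast
  then obtain \<Gamma>' where "prime \<Gamma>'" "\<Gamma> \<subseteq> \<Gamma>'" "can_acc \<Gamma>' \<Delta>"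
    using can_backward[OF th] by blast
  with \<Delta> show ?thesis using that by blast
qed

section \<open>Finite countermodels\<close>

lemma less_prod_encode: "0 < k \<Longrightarrow> n < prod_encode (k, n)"
proof -
  have "n \<le> triangle n" for n by (induction n) auto
  from this[of "k + n"] show "0 < k \<Longrightarrow> n < prod_encode (k, n)" by (simp add: prod_encode_def)
qed

text \<open>The tag must be positive, as \<open>prod_encode (0, 0) = 0\<close>;
  \<open>decode\<close> recurses only under positive tags.\<close>

lemma prod_decode_less:
  assumes "(k, m) = prod_decode n" "0 < k" shows "m < n"
  using less_prod_encode[OF assms(2), of m] assms(1) prod_decode_inverse[of n] by simp

lemma prod_decode_pair_less:
  assumes "(k, m) = prod_decode n" "(a, b) = prod_decode m" "0 < k" shows "a < n" "b < n"
  using le_prod_encode_1[of a b] le_prod_encode_2[of b a] prod_decode_less[OF assms(1,3)]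
    assms(2) prod_decode_inverse[of m] by simp_all

text \<open>Numbers that are not codes decode to arbitrary formulas, but compatibly with the arithmetic
  of the connectives; thus \<open>countermodel\<close> below need not single out the codes.\<close>

function decode :: "nat \<Rightarrow> fm" where
  "decode n = (case prod_decode n of (k, m) \<Rightarrow> (case prod_decode m of (a, b) \<Rightarrow>
     if k = 0 then Var m
     else if k = 2 then decode a \<^bold>\<and> decode b
     else if k = 3 then decode a \<^bold>\<or> decode b
     else if k = 4 then decode a \<^bold>\<longrightarrow> decode b
     else if k = 5 then \<^bold>\<diamond> decode m
     else if k = 6 then \<^bold>\<box> decode m
     else \<^bold>\<bottom>))"
  by auto
termination
  by (relation "measure id") (auto intro: prod_decode_less prod_decode_pair_less)

declare decode.simps [simp del]

lemma decode_prod_encode: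
  "decode (prod_encode (1, n)) = \<^bold>\<bottom>"
  "decode (prod_encode (2, prod_encode (a, b))) = (decode a \<^bold>\<and> decode b)"
  "decode (prod_encode (3, prod_encode (a, b))) = (decode a \<^bold>\<or> decode b)"
  "decode (prod_encode (4, prod_encode (a, b))) = (decode a \<^bold>\<longrightarrow> decode b)"
  "decode (prod_encode (5, a)) = \<^bold>\<diamond> (decode a)"
  "decode (prod_encode (6, a)) = \<^bold>\<box> (decode a)"
  by (simp_all add: decode.simps[of "prod_encode _"] split: prod.split)

lemma decode_code: "decode (code \<phi>) = \<phi>"
  using decode_prod_encode(1)[of 0]
  by (induction \<phi>) (simp_all add: decode_prod_encode decode.simps[of "prod_encode (0, _)"] split: prod.split)

lemma prod_encode_leD: "prod_encode (k, a) \<le> c \<Longrightarrow> a \<le> c"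
  using le_prod_encode_2 order_trans by blast

lemma prod_encode_pair_leD:
  assumes "prod_encode (k, prod_encode (a, b)) \<le> c" shows "a \<le> c" "b \<le> c"
  using prod_encode_leD[OF assms] le_prod_encode_1[of a b] le_prod_encode_2[of b a] by simp_all

section \<open>Traces, types and their relations\<close>

definition trace :: "nat \<Rightarrow> fm set \<Rightarrow> nat set" where
  "trace c \<Gamma> = {x. x \<le> c \<and> decode x \<in> \<Gamma>}"

definition chain_type :: "nat \<Rightarrow> fm set \<Rightarrow> nat set set" where
  "chain_type c \<Gamma> = trace c ` {\<Delta>. prime \<Delta> \<and> \<Gamma> \<subseteq> \<Delta>}"

definition type_le :: "nat \<Rightarrow> nat set set \<Rightarrow> nat set set \<Rightarrow> bool" where
  "type_le c t s \<longleftrightarrow> (\<exists>\<Gamma> \<Delta>. prime \<Gamma> \<and> prime \<Delta> \<and> \<Gamma> \<subseteq> \<Delta> \<and> t = chain_type c \<Gamma> \<and> s = chain_type c \<Delta>)"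

definition type_acc1 :: "nat \<Rightarrow> nat set set \<Rightarrow> nat set set \<Rightarrow> bool" where
  "type_acc1 c t s \<longleftrightarrow> (\<exists>\<Gamma> \<Delta>. prime \<Gamma> \<and> prime \<Delta> \<and> can_acc \<Gamma> \<Delta> \<and> t = chain_type c \<Gamma> \<and> s = chain_type c \<Delta>)"

text \<open>The image of a transitive relation under a quotient need not be transitive.\<close>

abbreviation type_acc :: "nat \<Rightarrow> nat set set \<Rightarrow> nat set set \<Rightarrow> bool" where
  "type_acc c \<equiv> (type_acc1 c)\<^sup>*\<^sup>*"

lemma trace_mono: "\<Gamma> \<subseteq> \<Delta> \<Longrightarrow> trace c \<Gamma> \<subseteq> trace c \<Delta>"
  unfolding trace_def by blast

text \<open>\<Gamma> is the least theory of its own chain, so its type remembers its trace, and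
  truth can be read off the type.\<close>

lemma Inter_chain_type: "prime \<Gamma> \<Longrightarrow> \<Inter> (chain_type c \<Gamma>) = trace c \<Gamma>"
  unfolding chain_type_def using trace_mono by blast

lemma in_chain_type: "prime \<Gamma> \<Longrightarrow> x \<in> \<Inter> (chain_type c \<Gamma>) \<longleftrightarrow> x \<le> c \<and> decode x \<in> \<Gamma>"
  unfolding Inter_chain_type trace_def by blast

text \<open>Linearity enters here: above a prime theory the type is determined by the trace, so equality
  of types is a bisimulation for the inclusion order.\<close>

lemma chain_type_above:
  assumes "prime \<Gamma>" "prime \<Delta>" "\<Gamma> \<subseteq> \<Delta>"
  shows "chain_type c \<Delta> = {A \<in> chain_type c \<Gamma>. trace c \<Delta> \<subseteq> A}"
proof (intro equalityI subsetI)
  fix A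
  assume "A \<in> chain_type c \<Delta>"
  then show "A \<in> {A \<in> chain_type c \<Gamma>. trace c \<Delta> \<subseteq> A}"
    using assms(3) trace_mono unfolding chain_type_def by blast
next
  fix A
  assume "A \<in> {A \<in> chain_type c \<Gamma>. trace c \<Delta> \<subseteq> A}"
  then obtain \<Theta> where \<Theta>: "prime \<Theta>" "\<Gamma> \<subseteq> \<Theta>" "A = trace c \<Theta>" "trace c \<Delta> \<subseteq> trace c \<Theta>"
    unfolding chain_type_def by blast
  from prime_connected[OF assms(1,2) \<Theta>(1) assms(3) \<Theta>(2)] show "A \<in> chain_type c \<Delta>"
  proof
    assume "\<Delta> \<subseteq> \<Theta>"
    then show ?thesis using \<Theta> unfolding chain_type_def by blast
  next
    assume "\<Theta> \<subseteq> \<Delta>"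
    then have "A = trace c \<Delta>" using \<Theta> trace_mono by blast
    then show ?thesis using assms(2) unfolding chain_type_def by blast
  qed
qed

text \<open>The trace of \<open>\<Delta>'\<close> belongs to the common type, hence some \<Delta>
  above \<Gamma> has the same trace, and by \<open>chain_type_above\<close> the same type.\<close>

lemma type_le_lift:
  assumes "type_le c (chain_type c \<Gamma>) s" "prime \<Gamma>"
  obtains \<Delta> where "prime \<Delta>" "\<Gamma> \<subseteq> \<Delta>" "s = chain_type c \<Delta>"
proof -
  obtain \<Gamma>' \<Delta>' where *: "prime \<Gamma>'" "prime \<Delta>'" "\<Gamma>' \<subseteq> \<Delta>'" "chain_type c \<Gamma> = chain_type c \<Gamma>'" "s = chain_type c \<Delta>'"
    using assms(1) unfolding type_le_def by blast
  then have "trace c \<Delta>' \<in> chain_type c \<Gamma>" unfolding chain_type_def by blast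
  then obtain \<Delta> where \<Delta>: "prime \<Delta>" "\<Gamma> \<subseteq> \<Delta>" "trace c \<Delta>' = trace c \<Delta>" unfolding chain_type_def by blast
  have "s = chain_type c \<Delta>"
    unfolding *(5) chain_type_above[OF *(1-3)] chain_type_above[OF assms(2) \<Delta>(1,2)] *(4) \<Delta>(3) ..
  then show ?thesis using that \<Delta> by blast
qed

lemma type_leI: "prime \<Gamma> \<Longrightarrow> prime \<Delta> \<Longrightarrow> \<Gamma> \<subseteq> \<Delta> \<Longrightarrow> type_le c (chain_type c \<Gamma>) (chain_type c \<Delta>)"
  unfolding type_le_def by blast

lemma type_acc1I: "prime \<Gamma> \<Longrightarrow> prime \<Delta> \<Longrightarrow> can_acc \<Gamma> \<Delta> \<Longrightarrow> type_acc1 c (chain_type c \<Gamma>) (chain_type c \<Delta>)"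
  unfolding type_acc1_def by blast

lemma type_le_source: assumes "type_le c t s" obtains \<Gamma> where "prime \<Gamma>" "t = chain_type c \<Gamma>"
  using assms unfolding type_le_def by blast

lemma type_le_trans: assumes "type_le c t s" "type_le c s u" shows "type_le c t u"
proof -
  obtain \<Gamma> where \<Gamma>: "prime \<Gamma>" "t = chain_type c \<Gamma>" using assms(1) by (rule type_le_source)
  obtain \<Delta> where \<Delta>: "prime \<Delta>" "\<Gamma> \<subseteq> \<Delta>" "s = chain_type c \<Delta>" using type_le_lift assms(1) \<Gamma> by blast
  obtain \<Theta> where "prime \<Theta>" "\<Delta> \<subseteq> \<Theta>" "u = chain_type c \<Theta>" using type_le_lift assms(2) \<Delta> by blast
  then show ?thesis using \<Gamma> \<Delta> type_leI[of \<Gamma> \<Theta>] by blast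
qed

lemma type_le_connected: assumes "type_le c t s" "type_le c t u" shows "type_le c s u \<or> type_le c u s"
proof -
  obtain \<Gamma> where \<Gamma>: "prime \<Gamma>" "t = chain_type c \<Gamma>" using assms(1) by (rule type_le_source)
  obtain \<Delta> where \<Delta>: "prime \<Delta>" "\<Gamma> \<subseteq> \<Delta>" "s = chain_type c \<Delta>" using type_le_lift assms(1) \<Gamma> by blast
  obtain \<Theta> where \<Theta>: "prime \<Theta>" "\<Gamma> \<subseteq> \<Theta>" "u = chain_type c \<Theta>" using type_le_lift assms(2) \<Gamma> by blast
  show ?thesis using prime_connected[OF \<Gamma>(1) \<Delta>(1) \<Theta>(1) \<Delta>(2) \<Theta>(2)] \<Delta> \<Theta> type_leI by blast
qed

text \<open>Squares are pasted edge by edge: \<open>type_le_lift\<close> moves the order step to the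
  representative that starts the next edge, where \<open>can_forward\<close> applies.\<close>

lemma type_acc_forward:
  assumes "type_le c t s" shows "type_acc c t u \<Longrightarrow> \<exists>z. type_acc c s z \<and> type_le c u z"
proof (induction rule: rtranclp_induct)
  case base
  then show ?case using assms by blast
next
  case (step u u')
  then obtain z where z: "type_acc c s z" "type_le c u z" by blast
  obtain \<Gamma> \<Delta> where \<Gamma>\<Delta>: "prime \<Gamma>" "prime \<Delta>" "can_acc \<Gamma> \<Delta>" "u = chain_type c \<Gamma>" "u' = chain_type c \<Delta>"
    using step.hyps(2) unfolding type_acc1_def by blast
  obtain \<Gamma>' where \<Gamma>': "prime \<Gamma>'" "\<Gamma> \<subseteq> \<Gamma>'" "z = chain_type c \<Gamma>'" using type_le_lift z(2) \<Gamma>\<Delta> by blast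
  obtain \<Delta>' where \<Delta>': "prime \<Delta>'" "\<Delta> \<subseteq> \<Delta>'" "can_acc \<Gamma>' \<Delta>'"
    using can_forward[OF \<Gamma>\<Delta>(1) \<Gamma>'(1) \<Gamma>\<Delta>(2) \<Gamma>'(2) \<Gamma>\<Delta>(3)] .
  have "type_acc c s (chain_type c \<Delta>')"
    using z(1) type_acc1I[OF \<Gamma>'(1) \<Delta>'(1,3)] \<Gamma>'(3) by (metis rtranclp.rtrancl_into_rtrancl)
  moreover have "type_le c u' (chain_type c \<Delta>')" using type_leI \<Gamma>\<Delta> \<Delta>' by blast
  ultimately show ?case by blast
qed

text \<open>Here the path is traversed from its end. Raising the target of an edge keeps the box
  half of \<open>can_acc\<close> but may break the diamond half, which is why
  \<open>can_backward\<close> assumes only the former.\<close>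

lemma type_acc_backward:
  assumes "type_le c s u" shows "type_acc c t s \<Longrightarrow> \<exists>z. type_le c t z \<and> type_acc c z u"
proof (induction rule: converse_rtranclp_induct)
  case base
  then show ?case using assms by blast
next
  case (step t t')
  then obtain z where z: "type_le c t' z" "type_acc c z u" by blast
  obtain \<Gamma> \<Delta> where \<Gamma>\<Delta>: "prime \<Gamma>" "prime \<Delta>" "can_acc \<Gamma> \<Delta>" "t = chain_type c \<Gamma>" "t' = chain_type c \<Delta>"
    using step.hyps(1) unfolding type_acc1_def by blast
  obtain \<Delta>' where \<Delta>': "prime \<Delta>'" "\<Delta> \<subseteq> \<Delta>'" "z = chain_type c \<Delta>'" using type_le_lift z(1) \<Gamma>\<Delta> by blast
  have "{\<phi>. \<^bold>\<box> \<phi> \<in> \<Gamma>} \<subseteq> \<Delta>'" using \<Gamma>\<Delta>(3) \<Delta>'(2) unfolding can_acc_def by blast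
  then obtain \<Gamma>' where \<Gamma>': "prime \<Gamma>'" "\<Gamma> \<subseteq> \<Gamma>'" "can_acc \<Gamma>' \<Delta>'"
    using can_backward[OF prime_theory[OF \<Gamma>\<Delta>(1)] \<Delta>'(1)] by blast
  have "type_acc c (chain_type c \<Gamma>') u"
    using z(2) type_acc1I[OF \<Gamma>'(1) \<Delta>'(1) \<Gamma>'(3)] \<Delta>'(3) by (metis converse_rtranclp_into_rtranclp)
  moreover have "type_le c t (chain_type c \<Gamma>')" using type_leI \<Gamma>\<Delta> \<Gamma>' by blast
  ultimately show ?case by blast
qed

text \<open>An edge turns the diamond into a double diamond, which the axiom contracts. The code of
  the double diamond may exceed \<open>c\<close>, but the contraction happens in the theory and not
  in its trace.\<close>

lemma type_acc_dia:
  assumes "prod_encode (5, a) \<in> \<Inter> s"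
  shows "type_acc c t s \<Longrightarrow> prod_encode (5, a) \<in> \<Inter> t"
proof (induction rule: converse_rtranclp_induct)
  case (step t t')
  obtain \<Gamma> \<Delta> where *: "prime \<Gamma>" "prime \<Delta>" "can_acc \<Gamma> \<Delta>" "t = chain_type c \<Gamma>" "t' = chain_type c \<Delta>"
    using step.hyps(1) unfolding type_acc1_def by blast
  have "\<^bold>\<diamond> decode a \<in> \<Delta>" "prod_encode (5, a) \<le> c"
    using step.IH unfolding *(5) in_chain_type[OF *(2)] decode_prod_encode by blast+
  moreover from this have "\<^bold>\<diamond> decode a \<in> \<Gamma>"
    using *(3) theory_GS4_mp[OF prime_theory[OF *(1)] GS4_axiom_schemes(5)]
    unfolding can_acc_def by blast
  ultimately show ?case unfolding *(4) in_chain_type[OF *(1)] decode_prod_encode by blast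
qed (rule assms)

lemma type_acc_box:
  assumes "prod_encode (6, a) \<in> \<Inter> t"
  shows "type_acc c t s \<Longrightarrow> prod_encode (6, a) \<in> \<Inter> s"
proof (induction rule: rtranclp_induct)
  case (step t t')
  obtain \<Gamma> \<Delta> where *: "prime \<Gamma>" "prime \<Delta>" "can_acc \<Gamma> \<Delta>" "t = chain_type c \<Gamma>" "t' = chain_type c \<Delta>"
    using step.hyps(2) unfolding type_acc1_def by blast
  have "\<^bold>\<box> decode a \<in> \<Gamma>" "prod_encode (6, a) \<le> c"
    using step.IH unfolding *(4) in_chain_type[OF *(1)] decode_prod_encode by blast+
  moreover from this have "\<^bold>\<box> decode a \<in> \<Delta>"
    using *(3) theory_GS4_mp[OF prime_theory[OF *(1)] GS4_axiom_schemes(6)]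
    unfolding can_acc_def by blast
  ultimately show ?case unfolding *(5) in_chain_type[OF *(2)] decode_prod_encode by blast
qed (rule assms)

text \<open>\<open>L\<close> and \<open>R\<close> are the order and the accessibility relation on the worlds \<open>{..<N}\<close>, and \<open>T w x\<close>
  says that \<open>w\<close> forces the formula with code \<open>x\<close>, for \<open>x \<le> c\<close>. Every code of a subformula is at most
  the code of the formula, and all quantifiers are bounded.\<close>

definition countermodel ::
  "nat \<Rightarrow> (nat \<Rightarrow> nat \<Rightarrow> bool) \<Rightarrow> (nat \<Rightarrow> nat \<Rightarrow> bool) \<Rightarrow> (nat \<Rightarrow> nat \<Rightarrow> bool) \<Rightarrow> nat \<Rightarrow> bool" where
  "countermodel N L R T c \<longleftrightarrow>
    (\<forall>w<N. L w w \<and> R w w) \<and>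
    (\<forall>w<N. \<forall>v<N. \<forall>u<N.
      (L w v \<and> L v u \<longrightarrow> L w u) \<and>
      (L w v \<and> L w u \<longrightarrow> L v u \<or> L u v) \<and>
      (R w v \<and> R v u \<longrightarrow> R w u) \<and>
      (L w v \<and> R w u \<longrightarrow> (\<exists>z<N. R v z \<and> L u z)) \<and>
      (R w v \<and> L v u \<longrightarrow> (\<exists>z<N. L w z \<and> R z u))) \<and>
    (\<forall>w<N. \<forall>v<N. \<forall>x<Suc c. L w v \<and> T w x \<longrightarrow> T v x) \<and>
    (\<forall>w<N. prod_encode (1, 0) \<le> c \<longrightarrow> \<not> T w (prod_encode (1, 0))) \<and>
    (\<forall>w<N. \<forall>a<Suc c. \<forall>b<Suc c.
      (prod_encode (2, prod_encode (a, b)) \<le> c \<longrightarrow>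
        (T w (prod_encode (2, prod_encode (a, b))) \<longleftrightarrow> T w a \<and> T w b)) \<and>
      (prod_encode (3, prod_encode (a, b)) \<le> c \<longrightarrow>
        (T w (prod_encode (3, prod_encode (a, b))) \<longleftrightarrow> T w a \<or> T w b)) \<and>
      (prod_encode (4, prod_encode (a, b)) \<le> c \<longrightarrow>
        (T w (prod_encode (4, prod_encode (a, b))) \<longleftrightarrow> (\<forall>v<N. L w v \<longrightarrow> T v a \<longrightarrow> T v b)))) \<and>
    (\<forall>w<N. \<forall>a<Suc c.
      (prod_encode (5, a) \<le> c \<longrightarrow>
        (T w (prod_encode (5, a)) \<longleftrightarrow> (\<exists>v<N. R w v \<and> T v a))) \<and>
      (prod_encode (6, a) \<le> c \<longrightarrow>
        (T w (prod_encode (6, a)) \<longleftrightarrow> (\<forall>v<N. L w v \<longrightarrow> (\<forall>u<N. R v u \<longrightarrow> T u a))))) \<and>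
    (\<exists>w<N. \<not> T w c)"

section \<open>Countermodels and non-theorems\<close>

lemma countermodel_exists:
  assumes "decode c \<notin> GS4"
  obtains N L R T where "N \<le> 2 ^ 2 ^ Suc c" "countermodel N L R T c"
proof -
  \<comment> \<open>Types are sets of subsets of \<open>{..c}\<close>, whence the double exponential
    of \<open>Suc c\<close>.\<close>
  let ?W = "chain_type c ` Collect prime"
  have sub: "?W \<subseteq> Pow (Pow {..c})" unfolding chain_type_def trace_def by auto
  have card: "card (Pow (Pow {..c})) = 2 ^ 2 ^ Suc c" by (simp add: card_Pow)
  obtain N where N: "N = card ?W" by blast
  have fin: "finite ?W" by (rule finite_subset[OF sub]) simp
  obtain h where h: "bij_betw h {0..<N} ?W" using ex_bij_betw_nat_finite[OF fin] N by blast
  have hW: "\<exists>\<Gamma>. prime \<Gamma> \<and> h w = chain_type c \<Gamma>" if "w < N" for w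
  proof -
    have "h w \<in> ?W" using bij_betwE[OF h] that by simp
    then show ?thesis by blast
  qed
  have Wh: "\<exists>w<N. h w = chain_type c \<Gamma>" if "prime \<Gamma>" for \<Gamma>
  proof -
    have "chain_type c \<Gamma> \<in> h ` {0..<N}" using bij_betw_imp_surj_on[OF h] that by simp
    then show ?thesis by auto
  qed
  have le_target: "\<exists>w<N. h w = s" if "type_le c t s" for t s
    using that Wh unfolding type_le_def by blast
  define L where "L w v = type_le c (h w) (h v)" for w v
  define R where "R w v = type_acc c (h w) (h v)" for w v
  define T where "T w x = (x \<in> \<Inter> (h w))" for w x
  have "countermodel N L R T c"
    unfolding countermodel_def
  proof (intro HOL.conjI allI impI)
    fix w
    assume "w < N"
    then obtain \<Gamma> where \<Gamma>: "prime \<Gamma>" "h w = chain_type c \<Gamma>" using hW by blast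
    note T = T_def[of w, unfolded \<Gamma>(2) in_chain_type[OF \<Gamma>(1)]] and th = prime_theory[OF \<Gamma>(1)]
    show "L w w" unfolding L_def \<Gamma>(2) using type_leI \<Gamma>(1) by blast
    show "R w w" unfolding R_def by simp
    show "\<not> T w (prod_encode (1, 0))"
      unfolding T decode_prod_encode using \<Gamma>(1) unfolding prime_def by blast
    {
      fix a b
      assume "prod_encode (2, prod_encode (a, b)) \<le> c"
      then show "T w (prod_encode (2, prod_encode (a, b))) = (T w a \<and> T w b)"
        using prod_encode_pair_leD[of 2 a b c] unfolding T decode_prod_encode theory_conj[OF th] by auto
    next
      fix a b
      assume "prod_encode (3, prod_encode (a, b)) \<le> c"
      then show "T w (prod_encode (3, prod_encode (a, b))) = (T w a \<or> T w b)"
        using prod_encode_pair_leD[of 3 a b c] unfolding T decode_prod_encode prime_disj[OF \<Gamma>(1)] by auto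
    next
      fix a b
      assume *: "prod_encode (4, prod_encode (a, b)) \<le> c"
      then have ab: "a \<le> c" "b \<le> c" by (rule prod_encode_pair_leD)+
      show "T w (prod_encode (4, prod_encode (a, b))) = (\<forall>v<N. L w v \<longrightarrow> T v a \<longrightarrow> T v b)"
      proof (intro iffI allI impI)
        fix v
        assume v: "T w (prod_encode (4, prod_encode (a, b)))" "v < N" "L w v" "T v a"
        obtain \<Delta> where \<Delta>: "prime \<Delta>" "\<Gamma> \<subseteq> \<Delta>" "h v = chain_type c \<Delta>"
          using v(3) type_le_lift \<Gamma>(1) unfolding L_def \<Gamma>(2) by blast
        show "T v b" using v(1,4) \<Delta>(2) ab theory_mp[OF prime_theory[OF \<Delta>(1)]]
          unfolding T T_def[of v] \<Delta>(3) in_chain_type[OF \<Delta>(1)] decode_prod_encode by blast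
      next
        assume all: "\<forall>v<N. L w v \<longrightarrow> T v a \<longrightarrow> T v b"
        have "decode b \<in> \<Delta>" if \<Delta>: "prime \<Delta>" "\<Gamma> \<subseteq> \<Delta>" "decode a \<in> \<Delta>" for \<Delta>
        proof -
          obtain v where v: "v < N" "h v = chain_type c \<Delta>" using Wh[OF \<Delta>(1)] by blast
          then have "L w v" unfolding L_def \<Gamma>(2) using type_leI \<Gamma>(1) \<Delta> by simp
          then have "T v a \<longrightarrow> T v b" using all v(1) by blast
          then show ?thesis using \<Delta>(3) ab(1)
            unfolding T_def[of v] v(2) in_chain_type[OF \<Delta>(1)] by blast
        qed
        then show "T w (prod_encode (4, prod_encode (a, b)))"
          using can_imp[OF \<Gamma>(1)] * unfolding T decode_prod_encode by blast
      qed
    next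
      fix a
      assume *: "prod_encode (5, a) \<le> c"
      then have a: "a \<le> c" by (rule prod_encode_leD)
      show "T w (prod_encode (5, a)) = (\<exists>v<N. R w v \<and> T v a)"
      proof
        assume "T w (prod_encode (5, a))"
        then have "\<^bold>\<diamond> decode a \<in> \<Gamma>" unfolding T decode_prod_encode by blast
        then obtain \<Delta> where \<Delta>: "prime \<Delta>" "can_acc \<Gamma> \<Delta>" "decode a \<in> \<Delta>"
          using can_dia[OF \<Gamma>(1)] by blast
        obtain v where v: "v < N" "h v = chain_type c \<Delta>" using Wh[OF \<Delta>(1)] by blast
        have "R w v" unfolding R_def v(2) \<Gamma>(2) using type_acc1I \<Gamma>(1) \<Delta>(1,2) by blast
        moreover have "T v a" unfolding T_def v(2) in_chain_type[OF \<Delta>(1)] using a \<Delta>(3) by blast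
        ultimately show "\<exists>v<N. R w v \<and> T v a" using v(1) by blast
      next
        assume "\<exists>v<N. R w v \<and> T v a"
        then obtain v where v: "v < N" "R w v" "T v a" by blast
        then obtain \<Delta> where \<Delta>: "prime \<Delta>" "h v = chain_type c \<Delta>" using hW by blast
        have "prod_encode (5, a) \<in> \<Inter> (h v)"
          using v(3) * theory_GS4_mp[OF prime_theory[OF \<Delta>(1)] GS4_axiom_schemes(4)]
          unfolding T_def \<Delta>(2) in_chain_type[OF \<Delta>(1)] decode_prod_encode by blast
        then show "T w (prod_encode (5, a))" using type_acc_dia v(2) unfolding T_def R_def by blast
      qed
    next
      fix a
      assume *: "prod_encode (6, a) \<le> c"
      then have a: "a \<le> c" by (rule prod_encode_leD)
      show "T w (prod_encode (6, a)) = (\<forall>v<N. L w v \<longrightarrow> (\<forall>u<N. R v u \<longrightarrow> T u a))"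
      proof (intro iffI allI impI)
        fix v u
        assume A: "T w (prod_encode (6, a))" "v < N" "L w v" "u < N" "R v u"
        obtain \<Delta> where \<Delta>: "prime \<Delta>" "\<Gamma> \<subseteq> \<Delta>" "h v = chain_type c \<Delta>"
          using A(3) type_le_lift \<Gamma>(1) unfolding L_def \<Gamma>(2) by blast
        \<comment> \<open>The box itself is carried up the order and along the whole path, and is
          opened only at the last world.\<close>
        have "prod_encode (6, a) \<in> \<Inter> (h v)"
          using A(1) \<Delta>(2) unfolding T \<Delta>(3) in_chain_type[OF \<Delta>(1)] by blast
        then have box: "prod_encode (6, a) \<in> \<Inter> (h u)" using type_acc_box A(5) unfolding R_def by blast
        obtain \<Theta> where \<Theta>: "prime \<Theta>" "h u = chain_type c \<Theta>" using A(4) hW by blast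
        show "T u a" using box a theory_GS4_mp[OF prime_theory[OF \<Theta>(1)] GS4_axiom_schemes(3)]
          unfolding T_def \<Theta>(2) in_chain_type[OF \<Theta>(1)] decode_prod_encode by blast
      next
        assume all: "\<forall>v<N. L w v \<longrightarrow> (\<forall>u<N. R v u \<longrightarrow> T u a)"
        have "\<^bold>\<box> decode a \<in> \<Gamma>"
        proof (rule ccontr)
          assume "\<^bold>\<box> decode a \<notin> \<Gamma>"
          then obtain \<Gamma>' \<Delta> where \<Delta>: "prime \<Gamma>'" "prime \<Delta>" "\<Gamma> \<subseteq> \<Gamma>'" "can_acc \<Gamma>' \<Delta>" "decode a \<notin> \<Delta>"
            using can_box[OF \<Gamma>(1)] by blast
          obtain v where v: "v < N" "h v = chain_type c \<Gamma>'" using Wh[OF \<Delta>(1)] by blast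
          obtain u where u: "u < N" "h u = chain_type c \<Delta>" using Wh[OF \<Delta>(2)] by blast
          have "L w v" unfolding L_def \<Gamma>(2) v(2) using type_leI \<Gamma>(1) \<Delta> by blast
          moreover have "R v u" unfolding R_def v(2) u(2) using type_acc1I \<Delta> by blast
          ultimately have "T u a" using all u(1) v(1) by blast
          then show False using \<Delta>(5) unfolding T_def u(2) in_chain_type[OF \<Delta>(2)] by blast
        qed
        then show "T w (prod_encode (6, a))" using * unfolding T decode_prod_encode by blast
      qed
    }
    fix v
    assume "v < N"
    {
      fix x
      assume "x < Suc c" and x: "L w v \<and> T w x"
      obtain \<Delta> where \<Delta>: "prime \<Delta>" "\<Gamma> \<subseteq> \<Delta>" "h v = chain_type c \<Delta>"
        using x type_le_lift \<Gamma>(1) unfolding L_def \<Gamma>(2) by blast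
      show "T v x" using x \<Delta>(2) unfolding T T_def[of v] \<Delta>(3) in_chain_type[OF \<Delta>(1)] by blast
    }
    fix u
    assume "u < N"
    show "L w u" if "L w v \<and> L v u" using that type_le_trans unfolding L_def by blast
    show "L v u \<or> L u v" if "L w v \<and> L w u" using that type_le_connected unfolding L_def by blast
    show "R w u" if "R w v \<and> R v u" using that rtranclp_trans unfolding R_def by metis
    show "\<exists>z<N. R v z \<and> L u z" if "L w v \<and> R w u"
      using that type_acc_forward le_target unfolding L_def R_def by metis
    show "\<exists>z<N. L w z \<and> R z u" if "R w v \<and> L v u"
      using that type_acc_backward le_target unfolding L_def R_def by metis
  next
    obtain \<Gamma> where \<Gamma>: "prime \<Gamma>" "decode c \<notin> \<Gamma>"
      using prime_avoiding[OF theory_of_GS4 assms] by blast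
    obtain w where "w < N" "h w = chain_type c \<Gamma>" using Wh[OF \<Gamma>(1)] by blast
    then show "\<exists>w<N. \<not> T w c" using \<Gamma> in_chain_type[OF \<Gamma>(1)] unfolding T_def by metis
  qed
  moreover have "N \<le> 2 ^ 2 ^ Suc c"
    using card_mono[OF _ sub] unfolding N card by simp
  ultimately show ?thesis using that by blast
qed

lemma countermodel_sound:
  assumes C: "countermodel N L R T (code \<phi>\<^sub>0)"
  shows "\<phi>\<^sub>0 \<notin> GS4"
proof
  assume "\<phi>\<^sub>0 \<in> GS4"
  \<comment> \<open>Numbers outside \<open>{..<N}\<close> become isolated worlds, so that the frame is all of \<open>nat\<close>.\<close>
  let ?L = "\<lambda>w v. w = v \<or> w < N \<and> v < N \<and> L w v"
  let ?R = "\<lambda>w v. w = v \<or> w < N \<and> v < N \<and> R w v"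
  let ?c = "code \<phi>\<^sub>0"
  note C1 = C[unfolded countermodel_def]
  note C2 = C1[THEN conjunct2] note C3 = C2[THEN conjunct2] note C4 = C3[THEN conjunct2]
  note C5 = C4[THEN conjunct2] note C6 = C5[THEN conjunct2] note C7 = C6[THEN conjunct2]
  have inst: "P k" if "\<forall>x<n. P x" "k < n" for P and k n :: nat using that by blast
  have refl: "L w w" "R w w" if "w < N" for w using inst[OF C1[THEN conjunct1] that] by blast+
  have frame:
    "L w v \<Longrightarrow> L v u \<Longrightarrow> L w u" "L w v \<Longrightarrow> L w u \<Longrightarrow> L v u \<or> L u v" "R w v \<Longrightarrow> R v u \<Longrightarrow> R w u"
    "L w v \<Longrightarrow> R w u \<Longrightarrow> \<exists>z<N. R v z \<and> L u z" "R w v \<Longrightarrow> L v u \<Longrightarrow> \<exists>z<N. L w z \<and> R z u"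
    if "w < N" "v < N" "u < N" for w v u
    using inst[OF inst[OF inst[OF C2[THEN conjunct1] that(1)] that(2)] that(3)] by blast+
  have mono: "T v x" if "w < N" "v < N" "x \<le> ?c" "L w v" "T w x" for w v x
    using inst[OF inst[OF inst[OF C3[THEN conjunct1] that(1)] that(2)] le_imp_less_Suc[OF that(3)]] that by blast
  have bot: "\<not> T w (prod_encode (1, 0))" if "w < N" "prod_encode (1, 0) \<le> ?c" for w
    using inst[OF C4[THEN conjunct1] that(1)] that(2) by blast
  have bin:
    "(prod_encode (2, prod_encode (a, b)) \<le> ?c \<longrightarrow>
        (T w (prod_encode (2, prod_encode (a, b))) \<longleftrightarrow> T w a \<and> T w b)) \<and>
      (prod_encode (3, prod_encode (a, b)) \<le> ?c \<longrightarrow>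
        (T w (prod_encode (3, prod_encode (a, b))) \<longleftrightarrow> T w a \<or> T w b)) \<and>
      (prod_encode (4, prod_encode (a, b)) \<le> ?c \<longrightarrow>
        (T w (prod_encode (4, prod_encode (a, b))) \<longleftrightarrow> (\<forall>v<N. L w v \<longrightarrow> T v a \<longrightarrow> T v b)))"
    if "w < N" "a \<le> ?c" "b \<le> ?c" for w a b
    by (rule inst[OF inst[OF inst[OF C5[THEN conjunct1] that(1)] le_imp_less_Suc[OF that(2)]]
        le_imp_less_Suc[OF that(3)]])
  have un: "(prod_encode (5, a) \<le> ?c \<longrightarrow>
        (T w (prod_encode (5, a)) \<longleftrightarrow> (\<exists>v<N. R w v \<and> T v a))) \<and>
      (prod_encode (6, a) \<le> ?c \<longrightarrow>
        (T w (prod_encode (6, a)) \<longleftrightarrow> (\<forall>v<N. L w v \<longrightarrow> (\<forall>u<N. R v u \<longrightarrow> T u a))))"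
    if "w < N" "a \<le> ?c" for w a
    by (rule inst[OF inst[OF C6[THEN conjunct1] that(1)] le_imp_less_Suc[OF that(2)]])
  interpret gs4_frame ?L ?R
  proof
    fix w v u
    show "?L w w" "?R w w" by auto
    show "?L w v \<Longrightarrow> ?L v u \<Longrightarrow> ?L w u" using frame(1) by blast
    show "?R w v \<Longrightarrow> ?R v u \<Longrightarrow> ?R w u" using frame(3) by blast
    show "?L w v \<Longrightarrow> ?L w u \<Longrightarrow> ?L v u \<or> ?L u v" using frame(2) by blast
    show "?L w v \<Longrightarrow> ?R w u \<Longrightarrow> \<exists>z. ?R v z \<and> ?L u z" using frame(4) by blast
    show "?R w v \<Longrightarrow> ?L v u \<Longrightarrow> \<exists>z. ?L w z \<and> ?R z u" using frame(5) by blast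
  qed
  \<comment> \<open>\<open>countermodel\<close> constrains \<open>T\<close> only for worlds below
    \<open>N\<close> and codes up to \<open>?c\<close>; elsewhere variables are false, which keeps
    \<open>V\<close> persistent.\<close>
  define V where "V n w \<longleftrightarrow> w < N \<and> code (Var n) \<le> ?c \<and> T w (code (Var n))" for n w
  have "persistent V" unfolding persistent_def V_def using mono by blast
  have truth: "sat V w \<phi> \<longleftrightarrow> T w (code \<phi>)" if "code \<phi> \<le> ?c" "w < N" for \<phi> w
    using that
  proof (induction \<phi> arbitrary: w)
    case (Var n)
    then show ?case unfolding V_def by simp
  next
    case Bot
    then show ?case using bot by simp
  next
    case (Conj \<phi> \<psi>)
    have le: "code \<phi> \<le> ?c" "code \<psi> \<le> ?c"
      using prod_encode_pair_leD[OF Conj.prems(1)[unfolded code.simps]] .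
    then show ?case using Conj bin[OF Conj.prems(2) le] by simp
  next
    case (Disj \<phi> \<psi>)
    have le: "code \<phi> \<le> ?c" "code \<psi> \<le> ?c"
      using prod_encode_pair_leD[OF Disj.prems(1)[unfolded code.simps]] .
    then show ?case using Disj bin[OF Disj.prems(2) le] by simp
  next
    case (Impl \<phi> \<psi>)
    have le: "code \<phi> \<le> ?c" "code \<psi> \<le> ?c"
      using prod_encode_pair_leD[OF Impl.prems(1)[unfolded code.simps]] .
    \<comment> \<open>For \<open>w < N\<close> the identity pairs added to \<open>?L\<close> are
      already in \<open>L\<close> by \<open>refl\<close>.\<close>
    have "sat V w (\<phi> \<^bold>\<longrightarrow> \<psi>) \<longleftrightarrow> (\<forall>v<N. L w v \<longrightarrow> sat V v \<phi> \<longrightarrow> sat V v \<psi>)"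
      using Impl.prems(2) refl by auto
    also have "\<dots> \<longleftrightarrow> (\<forall>v<N. L w v \<longrightarrow> T v (code \<phi>) \<longrightarrow> T v (code \<psi>))"
      using Impl.IH le by blast
    finally show ?case using bin[OF Impl.prems(2) le] Impl.prems(1) by simp
  next
    case (Dia \<phi>)
    have le: "code \<phi> \<le> ?c"
      using prod_encode_leD[OF Dia.prems(1)[unfolded code.simps]] .
    have "sat V w (\<^bold>\<diamond> \<phi>) \<longleftrightarrow> (\<exists>v<N. R w v \<and> sat V v \<phi>)"
      using Dia.prems(2) refl by auto
    also have "\<dots> \<longleftrightarrow> (\<exists>v<N. R w v \<and> T v (code \<phi>))"
      using Dia.IH le by blast
    finally show ?case using un[OF Dia.prems(2) le] Dia.prems(1) by simp
  next
    case (Box \<phi>)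
    have le: "code \<phi> \<le> ?c"
      using prod_encode_leD[OF Box.prems(1)[unfolded code.simps]] .
    have "sat V w (\<^bold>\<box> \<phi>) \<longleftrightarrow> (\<forall>v<N. L w v \<longrightarrow> (\<forall>u<N. R v u \<longrightarrow> sat V u \<phi>))"
      using Box.prems(2) refl by auto
    also have "\<dots> \<longleftrightarrow> (\<forall>v<N. L w v \<longrightarrow> (\<forall>u<N. R v u \<longrightarrow> T u (code \<phi>)))"
      using Box.IH le by blast
    finally show ?case using un[OF Box.prems(2) le] Box.prems(1) by simp
  qed
  obtain w where "w < N" "\<not> T w ?c" using C7 by blast
  then show False
    using soundness[OF \<open>\<phi>\<^sub>0 \<in> GS4\<close>] \<open>persistent V\<close> truth[of \<phi>\<^sub>0 w] unfolding valid_def by blast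
qed

section \<open>Countermodels as numbers\<close>

lemma ex_bits:
  obtains l :: nat where "l < 2 ^ (M * K)"
    "\<And>i j. i < M \<Longrightarrow> j < K \<Longrightarrow> i * K + j \<in> set_decode l \<longleftrightarrow> P i j"
proof -
  \<comment> \<open>A Boolean matrix is stored row by row, one bit per entry; as
    \<open>j < K\<close>, division by \<open>K\<close> recovers the row. Quantifying over relations
    thus becomes bounded quantification over numbers.\<close>
  let ?A = "{i * K + j |i j. i < M \<and> j < K \<and> P i j}"
  have lt: "i * K + j < M * K" if "i < M" "j < K" for i j
  proof -
    have "i * K + j < Suc i * K" using that(2) by simp
    also have "\<dots> \<le> M * K" using that(1) by (intro mult_le_mono1) simp
    finally show ?thesis .
  qed
  have sub: "?A \<subseteq> {..<M * K}" using lt by auto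
  then have fin: "finite ?A" by (rule finite_subset) simp
  have "set_encode ?A \<le> (\<Sum>k<M * K. 2 ^ k)"
    unfolding set_encode_def using sub by (intro sum_mono2) auto
  also have "(\<Sum>k<n. 2 ^ k) < (2 :: nat) ^ n" for n by (induction n) auto
  finally have "set_encode ?A < 2 ^ (M * K)" .
  moreover have "i * K + j \<in> set_decode (set_encode ?A) \<longleftrightarrow> P i j" if "i < M" "j < K" for i j
  proof -
    have "i * K + j \<in> set_decode (set_encode ?A) \<longleftrightarrow> i * K + j \<in> ?A" using fin by simp
    also have "\<dots> \<longleftrightarrow> P i j"
    proof
      assume "i * K + j \<in> ?A"
      then obtain i' j' where eq: "i * K + j = i' * K + j'" and *: "j' < K" "P i' j'" by blast
      have "i = i'" using arg_cong[OF eq, of "\<lambda>n. n div K"] that *(1) by simp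
      with eq * show "P i j" by simp
    qed (use that in blast)
    finally show ?thesis .
  qed
  ultimately show ?thesis using that by blast
qed

text \<open>The bounds on worlds and the guards \<open>\<le> c\<close> on composite codes confine
  \<open>countermodel\<close> to the entries that the bit matrices prescribe.\<close>

lemma countermodel_cong:
  assumes "\<And>w v. w < N \<Longrightarrow> v < N \<Longrightarrow> L' w v \<longleftrightarrow> L w v"
    and "\<And>w v. w < N \<Longrightarrow> v < N \<Longrightarrow> R' w v \<longleftrightarrow> R w v"
    and "\<And>w x. w < N \<Longrightarrow> x < Suc c \<Longrightarrow> T' w x \<longleftrightarrow> T w x"
  shows "countermodel N L' R' T' c \<longleftrightarrow> countermodel N L R T c"
  unfolding countermodel_def
  by (intro arg_cong2[where f = "(\<and>)"]; simp add: assms cong: conj_cong)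

text \<open>The rows have length \<open>N\<close> for the two relations and \<open>Suc c\<close> for
  truth, one entry for each number up to \<open>c\<close>. The outer \<open>Suc\<close> in the bound
  for \<open>N\<close> makes the strict quantifier include the maximal number of types.\<close>

definition refutable :: "nat \<Rightarrow> bool" where
  "refutable c \<longleftrightarrow> (\<exists>N<Suc (2 ^ 2 ^ Suc c). \<exists>l<2 ^ (N * N). \<exists>r<2 ^ (N * N). \<exists>t<2 ^ (N * Suc c).
    countermodel N (\<lambda>w v. w * N + v \<in> set_decode l) (\<lambda>w v. w * N + v \<in> set_decode r)
      (\<lambda>w x. w * Suc c + x \<in> set_decode t) c)"

lemma refutable_iff: "refutable (code \<phi>) \<longleftrightarrow> \<phi> \<notin> GS4"
proof
  assume "refutable (code \<phi>)"
  then show "\<phi> \<notin> GS4" unfolding refutable_def using countermodel_sound by blast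
next
  let ?c = "code \<phi>"
  assume "\<phi> \<notin> GS4"
  then obtain N L R T where N: "N \<le> 2 ^ 2 ^ Suc ?c" and C: "countermodel N L R T ?c"
    using countermodel_exists[of ?c] unfolding decode_code by blast
  obtain l :: nat where l: "l < 2 ^ (N * N)" "\<And>i j. i < N \<Longrightarrow> j < N \<Longrightarrow> i * N + j \<in> set_decode l \<longleftrightarrow> L i j"
    using ex_bits[of N N L] by blast
  obtain r :: nat where r: "r < 2 ^ (N * N)" "\<And>i j. i < N \<Longrightarrow> j < N \<Longrightarrow> i * N + j \<in> set_decode r \<longleftrightarrow> R i j"
    using ex_bits[of N N R] by blast
  obtain t :: nat where t: "t < 2 ^ (N * Suc ?c)"
    "\<And>i j. i < N \<Longrightarrow> j < Suc ?c \<Longrightarrow> i * Suc ?c + j \<in> set_decode t \<longleftrightarrow> T i j"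
    using ex_bits[of N "Suc ?c" T] by blast
  have "countermodel N (\<lambda>w v. w * N + v \<in> set_decode l) (\<lambda>w v. w * N + v \<in> set_decode r)
      (\<lambda>w x. w * Suc ?c + x \<in> set_decode t) ?c"
    by (rule iffD2[OF countermodel_cong C]) (use l(2) r(2) t(2) in auto)
  moreover have "N < Suc (2 ^ 2 ^ Suc ?c)" using N by simp
  ultimately show "refutable ?c" unfolding refutable_def using l(1) r(1) t(1) by blast
qed

text \<open>The closure rules follow the syntax of the definition, each quantifier adding a variable
  to the environment; what remains are index bounds.\<close>

lemma decides_refutable: "decides 1 (\<lambda>e. refutable (e 0))"
  unfolding refutable_def countermodel_def
  by (intro computable_intros computable_const; simp)

theorem mainTheorem5: "decidable GS4"
proof -
  obtain f where f: "\<And>e. evals f (map e [0..<1]) (of_bool (\<not> refutable (e 0)))"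
    using decides_not[OF decides_refutable] unfolding decides_def computable_def by blast
  have "evals f [code \<phi>] (if \<phi> \<in> GS4 then 1 else 0)" for \<phi>
    using f[of "\<lambda>_. code \<phi>"] by (simp add: refutable_iff of_bool_def)
  then show ?thesis unfolding decidable_def by blast
qed

end
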